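(* The inequality $$u(0,0)^2\le \mathrm{K}_2(\theta)\,\|u\|^{2\theta}\,\|\nabla u\|^{2(1-\theta)}\qquad\text{for all }u\in l^2(\mathbb{Z}^2)$$ holds (with a finite constant) for every $\theta\in(0,1]$. For $\theta\in(0,1)$ the sharp (smallest possible) constant is $$\mathrm{K}_2(\theta)=\frac{1}{\theta^\theta(1-\theta)^{1-\theta}}\cdot\max_{\lambda>0}\bigl(\lambda^{\theta}G_\lambda(0,0)\bigr),\qquad G_\lambda(0,0)=\frac2\pi\,\frac{K\!\left(\frac{4}{4+\lambda}\right)}{4+\lambda}\quad(\lambda>0),$$ and for each $0<\theta<1$ there exists a unique (up to a constant factor) extremal sequence $u_{\lambda_*}=G_{\lambda_*}$, where $\lambda_*=\operatorname{argmax}_{\lambda>0}\bigl(\lambda^{\theta}G_\lambda(0,0)\bigr)$. Finally, the sharp constant for $\theta=1$ is $\mathrm{K}_2(1)=1$ with extremal $u_*=\delta$, and $$\mathrm{K}_2(\theta)=\frac1{4\pi e\,\theta}+o\!\left(\frac1\theta\right)\quad\text{as }\theta\to0^+.$$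
   Context: Sequences are real-valued. For $u\in l^2(\mathbb{Z}^2)$: $\mathrm{D}_1u(n,m)=u(n+1,m)-u(n,m)$, $\mathrm{D}_2u(n,m)=u(n,m+1)-u(n,m)$, $\|\cdot\|$ is the $l^2$-norm, $\|\nabla u\|^2=\|\mathrm{D}_1u\|^2+\|\mathrm{D}_2u\|^2$, and $-\Delta=\mathrm{D}_1^*\mathrm{D}_1+\mathrm{D}_2^*\mathrm{D}_2$. The sequence $\delta$ equals $1$ at $(0,0)$ and $0$ elsewhere. For $\lambda>0$, $G_\lambda\in l^2(\mathbb{Z}^2)$ is the Green's function, the solution of $(-\Delta+\lambda)G_\lambda=\delta$. $K(k)=\int_0^1\frac{dt}{\sqrt{(1-t^2)(1-k^2t^2)}}$ is the complete elliptic integral of the first kind with modulus $k$. An extremal sequence is a nonzero $u$ for which the inequality with the sharp constant is an equality. *)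

theory Defs
  imports "HOL-Analysis.Analysis" "HOL-Library.Landau_Symbols"
begin

type_synonym seq2 = "int \<times> int \<Rightarrow> real"

definition l2 :: "seq2 set" where
  "l2 = {u. (\<lambda>x. (u x)\<^sup>2) summable_on UNIV}"

definition l2_inner :: "seq2 \<Rightarrow> seq2 \<Rightarrow> real" where
  "l2_inner u v = (\<Sum>\<^sub>\<infinity>x. u x * v x)"

definition l2_norm :: "seq2 \<Rightarrow> real" where
  "l2_norm u = sqrt (l2_inner u u)"

definition D1 :: "seq2 \<Rightarrow> seq2" where
  "D1 u = (\<lambda>(n, m). u (n + 1, m) - u (n, m))"

definition D2 :: "seq2 \<Rightarrow> seq2" where
  "D2 u = (\<lambda>(n, m). u (n, m + 1) - u (n, m))"

definition grad_norm :: "seq2 \<Rightarrow> real" where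
  "grad_norm u = sqrt ((l2_norm (D1 u))\<^sup>2 + (l2_norm (D2 u))\<^sup>2)"

text \<open>The Hilbert space adjoint on \<open>l2\<close> of an operator \<open>T\<close>; it is only meaningful for
  bounded linear \<open>T\<close> and arguments \<open>v\<close> in \<open>l2\<close>.\<close>

definition l2_adjoint :: "(seq2 \<Rightarrow> seq2) \<Rightarrow> seq2 \<Rightarrow> seq2" where
  "l2_adjoint T v = (THE w. w \<in> l2 \<and> (\<forall>u\<in>l2. l2_inner (T u) v = l2_inner u w))"

definition neg_laplacian :: "seq2 \<Rightarrow> seq2" where
  "neg_laplacian u = (\<lambda>x. l2_adjoint D1 (D1 u) x + l2_adjoint D2 (D2 u) x)"

definition delta :: seq2 where
  "delta x = (if x = (0, 0) then 1 else 0)"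

definition green :: "real \<Rightarrow> seq2" where
  "green a = (THE G. G \<in> l2 \<and> (\<forall>x. neg_laplacian G x + a * G x = delta x))"

definition elliptic_K :: "real \<Rightarrow> real" where
  "elliptic_K k = integral {0..1} (\<lambda>t. 1 / sqrt ((1 - t\<^sup>2) * (1 - k\<^sup>2 * t\<^sup>2)))"

text \<open>A nonzero \<open>u\<close> in \<open>l2\<close> has \<open>grad_norm u > 0\<close>, so the Isabelle convention
  \<open>0 powr 0 = 0\<close> matters below only for \<open>u = 0\<close>, where both sides of the inequality vanish.\<close>

definition interp_rhs :: "real \<Rightarrow> seq2 \<Rightarrow> real" where
  "interp_rhs \<theta> u = l2_norm u powr (2 * \<theta>) * grad_norm u powr (2 * (1 - \<theta>))"

definition interp_ineq :: "real \<Rightarrow> real \<Rightarrow> bool" where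
  "interp_ineq \<theta> C \<longleftrightarrow> (\<forall>u\<in>l2. (u (0, 0))\<^sup>2 \<le> C * interp_rhs \<theta> u)"

definition sharp_const :: "real \<Rightarrow> real" where
  "sharp_const \<theta> = Inf {C. interp_ineq \<theta> C}"

definition extremal :: "real \<Rightarrow> seq2 \<Rightarrow> bool" where
  "extremal \<theta> u \<longleftrightarrow> u \<in> l2 \<and> u \<noteq> (\<lambda>x. 0) \<and> (u (0, 0))\<^sup>2 = sharp_const \<theta> * interp_rhs \<theta> u"

end

theory Submission
  imports Defs "HOL-Real_Asymp.Real_Asymp"
begin

text \<open>The Green's function represents evaluation at the origin in the energy form
  \<open>\<parallel>\<nabla>u\<parallel>\<^sup>2 + a \<parallel>u\<parallel>\<^sup>2\<close>, so \<open>u(0,0)\<^sup>2 \<le> (\<parallel>\<nabla>u\<parallel>\<^sup>2 + a \<parallel>u\<parallel>\<^sup>2) G\<^sub>a(0,0)\<close> with equality only for multiples of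
  \<open>G\<^sub>a\<close>; optimising over \<open>a\<close> by Young's inequality turns this into the interpolation inequality.
  No Fourier analysis is needed for \<open>G\<^sub>a(0,0)\<close>: expanding the resolvent in powers of the adjacency
  operator counts closed lattice walks, of which there are \<open>(2j choose j)\<^sup>2\<close> of length \<open>2j\<close>, and this
  is the power series of \<open>K\<close>.
  The maximiser is unique because, with \<open>k = 4 / (4 + a)\<close>, the critical points of
  \<open>a\<^sup>\<theta> G\<^sub>a(0,0)\<close> are the solutions of \<open>E(k) / ((1 + k) K(k)) = \<theta>\<close>, whose left side is strictly
  decreasing from 1 to 0. The asymptotics follow from \<open>G\<^sub>a(0,0) = ln (1/a) / (4\<pi>) + O(1)\<close> as
  \<open>a \<rightarrow> 0\<close>, a consequence of Wallis' bounds for the central binomial coefficients.\<close>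

section \<open>The energy form on \<open>l2\<close>\<close>

lemma bij_shift: "bij (\<lambda>x::int \<times> int. x + z)"
  by (rule bij_betwI[where g = "\<lambda>x. x - z"]) auto

lemma summable_on_shift:
  fixes f :: "int \<times> int \<Rightarrow> real"
  shows "(\<lambda>x. f (x + z)) summable_on UNIV \<longleftrightarrow> f summable_on UNIV"
  by (rule summable_on_reindex_bij_betw[OF bij_shift])

lemma infsum_shift:
  fixes f :: "int \<times> int \<Rightarrow> real"
  shows "(\<Sum>\<^sub>\<infinity>x. f (x + z)) = (\<Sum>\<^sub>\<infinity>x. f x)"
  by (rule infsum_reindex_bij_betw[OF bij_shift])

lemma l2_shift: "u \<in> l2 \<Longrightarrow> (\<lambda>x. u (x + z)) \<in> l2"
  using summable_on_shift[of "\<lambda>x. (u x)\<^sup>2" z] by (simp add: l2_def)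

lemma l2_mult_summable:
  assumes "u \<in> l2" "v \<in> l2"
  shows "(\<lambda>x. u x * v x) summable_on UNIV"
proof -
  have "(\<lambda>x. (u x)\<^sup>2 + (v x)\<^sup>2) summable_on UNIV"
    using assms by (intro summable_on_add) (auto simp: l2_def)
  moreover have "norm (u x * v x) \<le> (u x)\<^sup>2 + (v x)\<^sup>2" for x
  proof -
    have "0 \<le> (\<bar>u x\<bar> - \<bar>v x\<bar>)\<^sup>2" "0 \<le> \<bar>u x\<bar> * \<bar>v x\<bar>" by simp_all
    moreover have "(\<bar>u x\<bar> - \<bar>v x\<bar>)\<^sup>2 = (u x)\<^sup>2 + (v x)\<^sup>2 - 2 * (\<bar>u x\<bar> * \<bar>v x\<bar>)"
      by (simp add: power2_diff)
    moreover have "norm (u x * v x) = \<bar>u x\<bar> * \<bar>v x\<bar>" by (simp add: abs_mult)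
    ultimately show ?thesis by linarith
  qed
  ultimately have "(\<lambda>x. norm (u x * v x)) summable_on UNIV"
    by (rule summable_on_comparison_test) simp
  then show ?thesis by (rule abs_summable_summable)
qed

lemma l2_scale: "u \<in> l2 \<Longrightarrow> (\<lambda>x. c * u x) \<in> l2"
  by (auto simp: l2_def power_mult_distrib intro: summable_on_cmult_right)

lemma l2_add:
  assumes "u \<in> l2" "v \<in> l2"
  shows "(\<lambda>x. u x + v x) \<in> l2"
proof -
  have "(\<lambda>x. (u x)\<^sup>2 + (v x)\<^sup>2 + 2 * (u x * v x)) summable_on UNIV"
    using assms l2_mult_summable[OF assms]
    by (intro summable_on_add summable_on_cmult_right) (auto simp: l2_def)
  then show ?thesis by (simp add: l2_def power2_sum algebra_simps)
qed

lemma l2_diff: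
  assumes "u \<in> l2" "v \<in> l2"
  shows "(\<lambda>x. u x - v x) \<in> l2"
  using l2_add[OF assms(1) l2_scale[OF assms(2), of "-1"]] by simp

lemma l2_inner_commute: "l2_inner u v = l2_inner v u"
  by (simp add: l2_inner_def mult.commute)

lemma l2_inner_add_right:
  assumes "u \<in> l2" "v \<in> l2" "w \<in> l2"
  shows "l2_inner u (\<lambda>x. v x + w x) = l2_inner u v + l2_inner u w"
  unfolding l2_inner_def distrib_left
  by (intro infsum_add l2_mult_summable assms)

lemma l2_inner_scale_right: "l2_inner u (\<lambda>x. c * v x) = c * l2_inner u v"
proof -
  have "l2_inner u (\<lambda>x. c * v x) = (\<Sum>\<^sub>\<infinity>x. c * (u x * v x))"
    by (simp add: l2_inner_def mult.left_commute)
  then show ?thesis by (simp add: l2_inner_def infsum_cmult_right')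
qed

lemma l2_inner_diff_right:
  assumes "u \<in> l2" "v \<in> l2" "w \<in> l2"
  shows "l2_inner u (\<lambda>x. v x - w x) = l2_inner u v - l2_inner u w"
  using l2_inner_add_right[OF assms(1,2) l2_scale[OF assms(3), of "-1"]]
    l2_inner_scale_right[of u "-1" w] by simp

lemma l2_inner_shift: "l2_inner (\<lambda>x. u (x + z)) v = l2_inner u (\<lambda>x. v (x - z))"
  using infsum_shift[of "\<lambda>x. u x * v (x - z)" z] by (simp add: l2_inner_def)

lemma l2_inner_point:
  assumes "\<And>x. x \<noteq> y \<Longrightarrow> v x = 0"
  shows "l2_inner u v = u y * v y"
proof -
  have "l2_inner u v = infsum (\<lambda>x. u x * v x) {y}"
    unfolding l2_inner_def by (rule infsum_cong_neutral) (use assms in auto)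
  then show ?thesis by simp
qed

lemma point_l2:
  fixes v :: seq2
  assumes "\<And>x. x \<noteq> y \<Longrightarrow> v x = 0"
  shows "v \<in> l2"
proof -
  have "(\<lambda>x. (v x)\<^sup>2) summable_on UNIV \<longleftrightarrow> (\<lambda>x. (v x)\<^sup>2) summable_on {y}"
    by (rule summable_on_cong_neutral) (use assms in auto)
  then show ?thesis by (simp add: l2_def)
qed

lemma l2_inner_ge:
  assumes "u \<in> l2"
  shows "(u x)\<^sup>2 \<le> l2_inner u u"
proof -
  have "infsum (\<lambda>x. u x * u x) {x} \<le> l2_inner u u" unfolding l2_inner_def
    by (rule infsum_mono_neutral) (use l2_mult_summable[OF assms assms] in auto)
  then show ?thesis by (simp add: power2_eq_square)
qed

lemma l2_inner_nonneg: "0 \<le> l2_inner u u"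
  unfolding l2_inner_def by (rule infsum_nonneg) simp

lemma l2_norm_sq: "(l2_norm u)\<^sup>2 = l2_inner u u"
  by (simp add: l2_norm_def l2_inner_nonneg)

lemma ex_nonzero: "u \<noteq> (\<lambda>x. 0) \<Longrightarrow> \<exists>x. u x \<noteq> (0 :: real)"
  by (rule ccontr) (simp add: fun_eq_iff)

lemma l2_inner_pos:
  assumes "u \<in> l2" "u \<noteq> (\<lambda>x. 0)"
  shows "l2_inner u u > 0"
proof -
  obtain x where "u x \<noteq> 0" using ex_nonzero[OF assms(2)] by blast
  then have "0 < (u x)\<^sup>2" by simp
  also note l2_inner_ge[OF assms(1)]
  finally show ?thesis .
qed

section \<open>Difference operators, their adjoints and the discrete Laplacian\<close>

text \<open>An arbitrary direction \<open>z\<close> covers \<open>D1\<close>, \<open>D2\<close> and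
  their adjoints at once, since the adjoint is again a difference, along \<open>- z\<close>.\<close>

definition fdiff :: "int \<times> int \<Rightarrow> seq2 \<Rightarrow> seq2" where
  "fdiff z u = (\<lambda>x. u (x + z) - u x)"

lemma D1_eq_fdiff: "D1 = fdiff (1, 0)"
  by (auto simp: D1_def fdiff_def fun_eq_iff)

lemma D2_eq_fdiff: "D2 = fdiff (0, 1)"
  by (auto simp: D2_def fdiff_def fun_eq_iff)

lemma fdiff_l2: "u \<in> l2 \<Longrightarrow> fdiff z u \<in> l2"
  unfolding fdiff_def by (intro l2_diff l2_shift)

text \<open>Summation by parts: shift invariance of the sum moves the translation from
  \<open>u\<close> to \<open>v\<close> with the opposite sign.\<close>

lemma fdiff_adjoint:
  assumes "u \<in> l2" "v \<in> l2"
  shows "l2_inner (fdiff z u) v = l2_inner u (fdiff (- z) v)"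
proof -
  have "l2_inner (fdiff z u) v = l2_inner (\<lambda>x. u (x + z)) v - l2_inner u v"
    using l2_inner_diff_right[OF assms(2) l2_shift[OF assms(1)] assms(1), of z]
    by (simp add: fdiff_def l2_inner_commute)
  also have "\<dots> = l2_inner u (fdiff (- z) v)"
    using l2_inner_diff_right[OF assms(1) l2_shift[OF assms(2), of "- z"] assms(2)]
    by (simp add: l2_inner_shift fdiff_def)
  finally show ?thesis .
qed

lemma l2_adjoint_fdiff:
  assumes "v \<in> l2"
  shows "l2_adjoint (fdiff z) v = fdiff (- z) v"
  unfolding l2_adjoint_def
proof (rule the_equality)
  show "fdiff (- z) v \<in> l2 \<and> (\<forall>u\<in>l2. l2_inner (fdiff z u) v = l2_inner u (fdiff (- z) v))"
    using assms by (simp add: fdiff_l2 fdiff_adjoint)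
next
  fix w assume w: "w \<in> l2 \<and> (\<forall>u\<in>l2. l2_inner (fdiff z u) v = l2_inner u w)"
  show "w = fdiff (- z) v"
  proof
    fix y
    \<comment> \<open>Testing against the indicator of \<open>y\<close> reads off the value of any
      candidate adjoint at \<open>y\<close>, which settles uniqueness.\<close>
    define e :: seq2 where "e = (\<lambda>x. if x = y then 1 else 0)"
    have e: "e \<in> l2" by (rule point_l2[of y]) (simp add: e_def)
    have *: "l2_inner e h = h y" for h
      using l2_inner_point[of y e h] by (simp add: e_def l2_inner_commute)
    show "w y = fdiff (- z) v y"
      using w e fdiff_adjoint[OF e assms, of z] by (simp add: *)
  qed
qed

text \<open>Each direction \<open>z\<close> contributes the second difference
  \<open>2 * u x - u (x + z) - u (x - z)\<close>; together they form the five-point stencil.\<close>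

lemma neg_laplacian_eq:
  assumes "u \<in> l2"
  shows "neg_laplacian u x =
    4 * u x - (u (x + (1, 0)) + u (x - (1, 0)) + u (x + (0, 1)) + u (x - (0, 1)))"
proof -
  have "l2_adjoint (fdiff z) (fdiff z u) x = 2 * u x - u (x + z) - u (x - z)" for z
    using assms by (simp add: l2_adjoint_fdiff fdiff_l2) (simp add: fdiff_def)
  then show ?thesis by (simp add: neg_laplacian_def D1_eq_fdiff D2_eq_fdiff)
qed

lemma neg_laplacian_diff:
  assumes "u \<in> l2" "v \<in> l2"
  shows "neg_laplacian (\<lambda>x. u x - c * v x) y = neg_laplacian u y - c * neg_laplacian v y"
  using assms by (simp add: neg_laplacian_eq l2_diff l2_scale algebra_simps)

lemma neg_laplacian_l2: "u \<in> l2 \<Longrightarrow> neg_laplacian u \<in> l2"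
  unfolding neg_laplacian_def D1_eq_fdiff D2_eq_fdiff
  by (simp add: l2_adjoint_fdiff fdiff_l2 l2_add)

lemma l2_inner_neg_laplacian:
  assumes "u \<in> l2" "v \<in> l2"
  shows "l2_inner u (neg_laplacian v) = l2_inner (D1 u) (D1 v) + l2_inner (D2 u) (D2 v)"
  using assms unfolding neg_laplacian_def D1_eq_fdiff D2_eq_fdiff
  by (simp add: l2_adjoint_fdiff l2_inner_add_right fdiff_l2 fdiff_adjoint)

lemma grad_norm_sq: "(grad_norm u)\<^sup>2 = l2_inner (D1 u) (D1 u) + l2_inner (D2 u) (D2 u)"
  by (simp add: grad_norm_def l2_norm_sq l2_inner_nonneg)

text \<open>If \<open>D1 u\<close> vanished, \<open>u\<close> would be constant along horizontal
  lines; a nonzero constant is not square summable on a half-line.\<close>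

lemma grad_norm_pos:
  assumes "u \<in> l2" "u \<noteq> (\<lambda>x. 0)"
  shows "grad_norm u > 0"
proof -
  have "D1 u \<noteq> (\<lambda>x. 0)"
  proof
    assume "D1 u = (\<lambda>x. 0)"
    then have step: "u (n + 1, m) = u (n, m)" for n m
      by (auto simp: D1_def fun_eq_iff)
    obtain p q where pq: "u (p, q) \<noteq> 0" using ex_nonzero[OF assms(2)] by auto
    have const: "u (p + int i, q) = u (p, q)" for i
    proof (induction i)
      case (Suc i)
      then show ?case using step[of "p + int i" q] by (simp add: add.commute add.left_commute)
    qed simp
    have "inj (\<lambda>i::nat. (p + int i, q))" by (auto simp: inj_on_def)
    then have "(\<lambda>i. (u (p + int i, q))\<^sup>2) summable_on (UNIV :: nat set)"
      using summable_on_subset_banach[of "\<lambda>x. (u x)\<^sup>2" UNIV "range (\<lambda>i::nat. (p + int i, q))"]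
        assms(1) summable_on_reindex[of "\<lambda>i::nat. (p + int i, q)" UNIV "\<lambda>x. (u x)\<^sup>2"]
      by (auto simp: l2_def o_def)
    then have "summable (\<lambda>i::nat. (u (p, q))\<^sup>2)"
      by (simp add: const summable_on_UNIV_nonneg_real_iff)
    then show False using pq by (simp add: summable_const_iff)
  qed
  then have "l2_inner (D1 u) (D1 u) > 0"
    using assms(1) by (intro l2_inner_pos) (simp_all add: D1_eq_fdiff fdiff_l2)
  then have "(grad_norm u)\<^sup>2 > 0"
    unfolding grad_norm_sq using l2_inner_nonneg[of "D2 u"] by linarith
  moreover have "grad_norm u \<ge> 0" by (simp add: grad_norm_def)
  ultimately show ?thesis using less_eq_real_def by fastforce
qed

section \<open>The energy form and the representation of evaluation at the origin\<close>

definition energy :: "real \<Rightarrow> seq2 \<Rightarrow> real" where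
  "energy a u = (grad_norm u)\<^sup>2 + a * (l2_norm u)\<^sup>2"

lemma energy_eq_inner:
  assumes "u \<in> l2"
  shows "energy a u = l2_inner u (\<lambda>x. neg_laplacian u x + a * u x)"
  using assms
  by (simp add: energy_def l2_norm_sq grad_norm_sq l2_inner_add_right l2_inner_scale_right
      neg_laplacian_l2 l2_scale l2_inner_neg_laplacian)

lemma energy_pos:
  assumes "a > 0" "u \<in> l2" "u \<noteq> (\<lambda>x. 0)"
  shows "energy a u > 0"
  using assms l2_inner_pos[OF assms(2,3)] zero_le_power2[of "grad_norm u"]
  by (simp add: energy_def l2_norm_sq add_nonneg_pos)

lemma resolvent_symmetric:
  assumes "u \<in> l2" "v \<in> l2"
  shows "l2_inner u (\<lambda>x. neg_laplacian v x + a * v x) = l2_inner v (\<lambda>x. neg_laplacian u x + a * u x)"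
  using assms
  by (simp add: l2_inner_add_right l2_inner_scale_right
      neg_laplacian_l2 l2_scale l2_inner_neg_laplacian l2_inner_commute)

lemma l2_inner_delta: "l2_inner u delta = u (0, 0)"
  using l2_inner_point[of "(0,0)" delta u] by (simp add: delta_def)

lemma delta_l2: "delta \<in> l2"
  by (rule point_l2[of "(0,0)"]) (simp add: delta_def)

definition is_green :: "real \<Rightarrow> seq2 \<Rightarrow> bool" where
  "is_green a G \<longleftrightarrow> G \<in> l2 \<and> (\<forall>x. neg_laplacian G x + a * G x = delta x)"

text \<open>Bilinear expansion: since the resolvent form is symmetric and sends \<open>G\<close> to
  \<open>delta\<close>, both the cross term and the term quadratic in \<open>c\<close> are values at
  the origin.\<close>

lemma energy_diff_green:
  assumes G: "is_green a G" and u: "u \<in> l2"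
  shows "energy a (\<lambda>x. u x - c * G x) = energy a u - 2 * c * u (0, 0) + c\<^sup>2 * G (0, 0)"
proof -
  let ?R = "\<lambda>u x. neg_laplacian u x + a * u x"
  let ?w = "\<lambda>x. u x - c * G x"
  have G2: "G \<in> l2" and GR: "?R G = delta" using G by (auto simp: is_green_def)
  have w: "?w \<in> l2" using u G2 by (intro l2_diff l2_scale)
  have R2: "?R u \<in> l2" if "u \<in> l2" for u
    using that by (intro l2_add neg_laplacian_l2 l2_scale)
  have Rw: "?R ?w = (\<lambda>x. ?R u x - c * delta x)"
    unfolding GR[symmetric] using u G2
    by (auto simp: neg_laplacian_diff algebra_simps)
  have "energy a ?w = l2_inner ?w (?R u) - c * l2_inner ?w delta"
    using w u by (simp add: energy_eq_inner Rw l2_inner_diff_right R2 delta_l2 l2_scale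
        l2_inner_scale_right)
  also have "l2_inner ?w (?R u) = l2_inner u (?R ?w)"
    using w u by (rule resolvent_symmetric)
  also have "\<dots> = energy a u - c * u (0, 0)"
    using u by (simp add: energy_eq_inner Rw l2_inner_diff_right R2 delta_l2 l2_scale
        l2_inner_scale_right l2_inner_delta)
  finally show ?thesis by (simp add: l2_inner_delta power2_eq_square algebra_simps)
qed

lemma is_green_nonzero:
  assumes "is_green a G"
  shows "G \<noteq> (\<lambda>x. 0)"
proof
  assume G: "G = (\<lambda>x. 0)"
  then have "neg_laplacian G (0, 0) = 0"
    using assms by (subst neg_laplacian_eq) (auto simp: is_green_def)
  then show False using assms G unfolding is_green_def
    by (metis add_0 delta_def mult_zero_right zero_neq_one)
qed

lemma energy_green:
  assumes "is_green a G"
  shows "energy a G = G (0, 0)"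
proof -
  have "(\<lambda>x. neg_laplacian G x + a * G x) = delta"
  proof
    fix x show "neg_laplacian G x + a * G x = delta x"
      using assms unfolding is_green_def by blast
  qed
  then show ?thesis
    using assms by (simp add: is_green_def energy_eq_inner l2_inner_delta)
qed

lemma eq_diff_zero: "(\<lambda>x. u x - v x) = (\<lambda>x. 0) \<Longrightarrow> u = (v :: seq2)"
  by (simp add: fun_eq_iff)

text \<open>For distinct solutions the energy of the difference is positive, but it equals
  \<open>H (0, 0) - G (0, 0)\<close> and, with the roles exchanged,
  \<open>G (0, 0) - H (0, 0)\<close>.\<close>

lemma is_green_unique:
  assumes "a > 0" "is_green a G" "is_green a H"
  shows "G = H"
proof (rule ccontr)
  assume "G \<noteq> H"
  then have "energy a (\<lambda>x. G x - 1 * H x) > 0"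
    using assms \<open>G \<noteq> H\<close> by (intro energy_pos l2_diff l2_scale) (auto simp: is_green_def dest: eq_diff_zero)
  then have "G (0, 0) < H (0, 0)"
    using assms by (subst (asm) energy_diff_green) (auto simp: is_green_def energy_green)
  have "energy a (\<lambda>x. H x - 1 * G x) > 0"
    using assms \<open>G \<noteq> H\<close> by (intro energy_pos l2_diff l2_scale) (auto simp: is_green_def dest: eq_diff_zero)
  then have "H (0, 0) < G (0, 0)"
    using assms by (subst (asm) energy_diff_green) (auto simp: is_green_def energy_green)
  then show False using \<open>G (0, 0) < H (0, 0)\<close> by simp
qed

lemma green_eqI:
  assumes "a > 0" "is_green a G"
  shows "green a = G"
  unfolding green_def
proof (rule the_equality)
  fix H assume "H \<in> l2 \<and> (\<forall>x. neg_laplacian H x + a * H x = delta x)"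
  then show "H = G" using assms is_green_unique by (auto simp: is_green_def)
qed (use assms in \<open>auto simp: is_green_def\<close>)

text \<open>Completing the square in the energy form, for which \<open>G\<close> represents evaluation at the
  origin.\<close>

lemma point_eval_bound:
  assumes "a > 0" and G: "is_green a G" and u: "u \<in> l2"
  shows "G (0, 0) > 0" "(u (0, 0))\<^sup>2 \<le> energy a u * G (0, 0)"
    "(u (0, 0))\<^sup>2 = energy a u * G (0, 0) \<Longrightarrow> u = (\<lambda>x. u (0, 0) / G (0, 0) * G x)"
proof -
  have G2: "G \<in> l2" using G by (simp add: is_green_def)
  show pos: "G (0, 0) > 0"
    using energy_pos[OF assms(1) G2 is_green_nonzero[OF G]] energy_green[OF G] by simp
  \<comment> \<open>This \<open>c\<close> minimises the energy of \<open>u - c G\<close>, a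
    quadratic in \<open>c\<close>; it is also the value for which the difference vanishes at the
    origin.\<close>
  define c where "c = u (0, 0) / G (0, 0)"
  let ?w = "\<lambda>x. u x - c * G x"
  have w: "?w \<in> l2" using u G2 by (intro l2_diff l2_scale)
  have c: "c * G (0, 0) = u (0, 0)" using pos by (simp add: c_def)
  have "energy a ?w * G (0, 0)
      = energy a u * G (0, 0) - 2 * (c * G (0, 0)) * u (0, 0) + (c * G (0, 0))\<^sup>2"
    unfolding energy_diff_green[OF G u] by (simp add: algebra_simps power2_eq_square)
  then have E: "energy a ?w * G (0, 0) = energy a u * G (0, 0) - (u (0, 0))\<^sup>2"
    unfolding c by (simp add: power2_eq_square)
  have "energy a ?w \<ge> 0"
    using assms(1) by (simp add: energy_def)
  then show "(u (0, 0))\<^sup>2 \<le> energy a u * G (0, 0)"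
    using E pos mult_nonneg_nonneg[of "energy a ?w" "G (0, 0)"] by simp
  assume "(u (0, 0))\<^sup>2 = energy a u * G (0, 0)"
  then have "energy a ?w = 0" using E pos by simp
  then have "?w = (\<lambda>x. 0)" using energy_pos[OF assms(1) w] by fastforce
  then show "u = (\<lambda>x. u (0, 0) / G (0, 0) * G x)" unfolding c_def by (rule eq_diff_zero)
qed

section \<open>Lattice walks and the Green's function\<close>

text \<open>The number of nearest-neighbour walks of length \<open>k\<close> from the origin to
  \<open>x\<close>, that is, the \<open>k\<close>-th power of the adjacency operator applied to
  \<open>delta\<close>.\<close>

primrec walks :: "nat \<Rightarrow> seq2" where
  "walks 0 = delta"
| "walks (Suc k) =
    (\<lambda>x. walks k (x + (1, 0)) + walks k (x - (1, 0)) + walks k (x + (0, 1)) + walks k (x - (0, 1)))"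

lemma walks_nonneg: "0 \<le> walks k x"
  by (induction k arbitrary: x) (simp_all add: delta_def)

text \<open>Each step has four choices. The bound is uniform over finite sets, so summability over
  the lattice can later be derived from it.\<close>

lemma walks_sum_le:
  assumes "finite F"
  shows "sum (walks k) F \<le> 4 ^ k"
  using assms
proof (induction k arbitrary: F)
  case 0
  have "sum delta F = sum delta (F \<inter> {(0, 0)})"
    using 0 by (intro sum.mono_neutral_right) (auto simp: delta_def)
  also have "\<dots> \<le> 1" by (cases "(0, 0) \<in> F") (auto simp: delta_def Int_insert_right)
  finally show ?case by simp
next
  case (Suc k)
  have shift: "(\<Sum>x\<in>F. walks k (x + z)) \<le> 4 ^ k" for z
  proof -
    have "(\<Sum>x\<in>F. walks k (x + z)) = sum (walks k) ((\<lambda>x. x + z) ` F)"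
      by (subst sum.reindex) (simp_all add: inj_on_def)
    also have "\<dots> \<le> 4 ^ k" using Suc.prems by (intro Suc.IH) simp
    finally show ?thesis .
  qed
  show ?case
    using shift[of "(1, 0)"] shift[of "- (1, 0)"] shift[of "(0, 1)"] shift[of "- (0, 1)"]
    by (simp add: sum.distrib del: uminus_Pair)
qed

lemma walks_le: "walks k x \<le> 4 ^ k"
  using walks_sum_le[of "{x}" k] by simp

text \<open>The Neumann series: with the adjacency operator \<open>A\<close> the resolvent inverts
  \<open>(4 + a) - A\<close>, and its inverse expands as the sum of
  \<open>A ^ k / (4 + a) ^ Suc k\<close>.\<close>

definition walk_green :: "real \<Rightarrow> seq2" where
  "walk_green a x = (\<Sum>k. walks k x / (4 + a) ^ Suc k)"

lemma geometric_weights_sums: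
  fixes a :: real
  assumes "a > 0"
  shows "(\<lambda>k. 4 ^ k / (4 + a) ^ Suc k) sums (1 / a)"
proof -
  have "(\<lambda>k. (1 / (4 + a)) * (4 / (4 + a)) ^ k) sums ((1 / (4 + a)) * (1 / (1 - 4 / (4 + a))))"
    using assms by (intro sums_mult geometric_sums) simp
  moreover have "(1 / (4 + a)) * (1 / (1 - 4 / (4 + a))) = 1 / a"
    using assms by (simp add: field_simps)
  ultimately show ?thesis by (simp add: power_divide)
qed

lemma walk_green_summable:
  assumes "a > 0"
  shows "summable (\<lambda>k. walks k x / (4 + a) ^ Suc k)"
proof (rule summable_comparison_test')
  show "summable (\<lambda>k. 4 ^ k / (4 + a) ^ Suc k)"
    using geometric_weights_sums[OF assms] by (rule sums_summable)
  show "norm (walks k x / (4 + a) ^ Suc k) \<le> 4 ^ k / (4 + a) ^ Suc k" for k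
    using assms walks_le[of k x] walks_nonneg[of k x]
    by (simp add: divide_right_mono del: power_Suc)
qed

lemma walk_green_nonneg:
  assumes "a > 0"
  shows "0 \<le> walk_green a x"
  unfolding walk_green_def
  using assms walks_nonneg by (intro suminf_nonneg walk_green_summable) (auto intro!: divide_nonneg_nonneg)

text \<open>Exchanging the finite sum with the series leaves a geometric majorant. This bound on the
  total mass yields both membership in \<open>l2\<close> and
  \<open>G(0,0) \<le> 1/a\<close>.\<close>

lemma walk_green_sum_le:
  assumes "a > 0" "finite F"
  shows "sum (walk_green a) F \<le> 1 / a"
proof -
  have "(\<Sum>x\<in>F. walks k x / (4 + a) ^ Suc k) \<le> 4 ^ k / (4 + a) ^ Suc k" for k
    using walks_sum_le[OF assms(2), of k] assms(1)
    by (simp add: sum_divide_distrib[symmetric] divide_right_mono del: power_Suc)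
  moreover have "(\<lambda>k. \<Sum>x\<in>F. walks k x / (4 + a) ^ Suc k) sums sum (walk_green a) F"
    unfolding walk_green_def using assms(1) by (intro sums_sum summable_sums walk_green_summable)
  ultimately show ?thesis
    using geometric_weights_sums[OF assms(1)] by (rule sums_le)
qed

text \<open>A nonnegative summable function \<open>g\<close> bounded by \<open>1 / a\<close> is
  square summable, because its square is at most \<open>g / a\<close>.\<close>

lemma walk_green_l2:
  assumes "a > 0"
  shows "walk_green a \<in> l2"
proof -
  have "walk_green a summable_on UNIV"
    using walk_green_sum_le[OF assms] walk_green_nonneg[OF assms]
    by (intro nonneg_bdd_above_summable_on bdd_aboveI2[where M = "1 / a"]) auto
  then have "(\<lambda>x. 1 / a * walk_green a x) summable_on UNIV"
    by (rule summable_on_cmult_right)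
  moreover have "(walk_green a x)\<^sup>2 \<le> 1 / a * walk_green a x" for x
    using walk_green_sum_le[OF assms, of "{x}"] walk_green_nonneg[OF assms, of x]
    unfolding power2_eq_square by (intro mult_right_mono) auto
  ultimately show ?thesis
    unfolding l2_def mem_Collect_eq by (rule summable_on_comparison_test) simp
qed

text \<open>By the recursion of \<open>walks\<close>, summing over the four neighbours shifts the
  series by one index and multiplies it by \<open>4 + a\<close>; the lost zeroth term is the source
  \<open>delta\<close>.\<close>

lemma is_green_walk_green:
  assumes "a > 0"
  shows "is_green a (walk_green a)"
  unfolding is_green_def
proof (intro conjI allI walk_green_l2 assms)
  fix x
  let ?s = "\<lambda>x k. walks k x / (4 + a) ^ Suc k"
  have n: "4 + a \<noteq> 0" using assms by simp
  have s: "?s x sums walk_green a x" for x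
    unfolding walk_green_def using assms by (intro summable_sums walk_green_summable)
  let ?N = "walk_green a (x + (1, 0)) + walk_green a (x - (1, 0))
    + walk_green a (x + (0, 1)) + walk_green a (x - (0, 1))"
  have "(\<lambda>k. ?s (x + (1, 0)) k + ?s (x - (1, 0)) k + ?s (x + (0, 1)) k + ?s (x - (0, 1)) k) sums ?N"
    by (intro sums_add s)
  moreover have "?s (x + (1, 0)) k + ?s (x - (1, 0)) k + ?s (x + (0, 1)) k + ?s (x - (0, 1)) k
      = (4 + a) * ?s x (Suc k)" for k
    unfolding add_divide_distrib[symmetric] walks.simps power_Suc[of _ "Suc k"] using n
    by (simp del: power_Suc)
  ultimately have 1: "(\<lambda>k. (4 + a) * ?s x (Suc k)) sums ?N" by simp
  have "(\<lambda>k. (4 + a) * ?s x (Suc k)) sums ((4 + a) * (walk_green a x - ?s x 0))"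
    using s[of x] by (intro sums_mult) (subst sums_Suc_iff, simp)
  then have "?N = (4 + a) * (walk_green a x - ?s x 0)"
    using 1 sums_unique2 by blast
  also have "\<dots> = (4 + a) * walk_green a x - delta x"
    using assms by (simp add: right_diff_distrib)
  finally show "neg_laplacian (walk_green a) x + a * walk_green a x = delta x"
    by (simp add: neg_laplacian_eq[OF walk_green_l2[OF assms]] distrib_right)
qed

section \<open>Counting closed walks by one-dimensional walks\<close>

primrec line_walks :: "nat \<Rightarrow> int \<Rightarrow> real" where
  "line_walks 0 = (\<lambda>p. if p = 0 then 1 else 0)"
| "line_walks (Suc k) = (\<lambda>p. line_walks k (p + 1) + line_walks k (p - 1))"

text \<open>In the coordinates \<open>(n + m, n - m)\<close> every step of a planar walk changes both coordinates by
  \<open>\<plusminus>1\<close> independently.\<close>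

lemma walks_eq_line_walks: "walks k (n, m) = line_walks k (n + m) * line_walks k (n - m)"
proof (induction k arbitrary: n m)
  case 0
  have "n + m = 0 \<and> n - m = 0 \<longleftrightarrow> n = 0 \<and> m = 0" by presburger
  then show ?case by (auto simp: delta_def)
next
  case (Suc k)
  have "n + 1 + m = n + m + 1" "n + 1 - m = n - m + 1" "n - 1 + m = n + m - 1"
    "n - 1 - m = n - m - 1" "n + (m + 1) = n + m + 1" "n - (m + 1) = n - m - 1"
    "n + (m - 1) = n + m - 1" "n - (m - 1) = n - m + 1" by simp_all
  then show ?case by (simp only: walks.simps line_walks.simps Suc.IH add_Pair diff_Pair
        add_0_right diff_zero) (simp add: algebra_simps)
qed

lemma line_walks_outside: "p < - int k \<Longrightarrow> line_walks k p = 0"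
  by (induction k arbitrary: p) auto

lemma line_walks_odd: "odd (int k + p) \<Longrightarrow> line_walks k p = 0"
  by (induction k arbitrary: p) auto

text \<open>A walk with \<open>i\<close> of its \<open>k\<close> steps upwards ends at
  \<open>2 i - k\<close>, and the recursion becomes Pascal's rule.\<close>

lemma line_walks_binomial: "line_walks k (2 * int i - int k) = real (k choose i)"
proof (induction k arbitrary: i)
  case 0
  then show ?case by (cases i) auto
next
  case (Suc k)
  note IH = Suc.IH
  have 1: "line_walks k (2 * int i - int (Suc k) + 1) = real (k choose i)"
    using IH[of i] by (simp add: algebra_simps)
  show ?case
  proof (cases i)
    case 0
    \<comment> \<open>The lower neighbour is \<open>- k - 2\<close>, out of reach in
      \<open>k\<close> steps: the boundary case of Pascal's rule.\<close>
    then show ?thesis using 1 line_walks_outside[of "2 * int i - int (Suc k) - 1" k] by simp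
  next
    case (Suc j)
    have "2 * int i - int (Suc k) - 1 = 2 * int j - int k" using Suc by simp
    then have "line_walks k (2 * int i - int (Suc k) - 1) = real (k choose j)"
      by (simp only: IH)
    then show ?thesis using 1 Suc by simp
  qed
qed

definition central_weight :: "nat \<Rightarrow> real" where
  "central_weight j = real ((2 * j) choose j) / 4 ^ j"

lemma green_eq_walk_green: "a > 0 \<Longrightarrow> green a = walk_green a"
  by (rule green_eqI[OF _ is_green_walk_green])

text \<open>Odd lengths contribute nothing by parity. For length \<open>2 * j\<close> the closed
  walks number the square of the central binomial coefficient, and \<open>4 ^ (2 * j)\<close> is
  absorbed into the squared weight.\<close>

lemma green_origin_sums:
  assumes "a > 0"
  shows "(\<lambda>j. (central_weight j)\<^sup>2 * ((4 / (4 + a))\<^sup>2) ^ j) sums ((4 + a) * green a (0, 0))"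
proof -
  let ?f = "\<lambda>k. walks k (0, 0) / (4 + a) ^ Suc k"
  have s: "?f sums green a (0, 0)"
    unfolding green_eq_walk_green[OF assms] walk_green_def
    using assms by (intro summable_sums walk_green_summable)
  have odd: "?f k = 0" if "k \<notin> range (\<lambda>j. 2 * j)" for k
  proof -
    have "odd k" using that by (auto elim: evenE)
    then have "line_walks k 0 = 0" by (intro line_walks_odd) simp
    then show ?thesis by (simp add: walks_eq_line_walks)
  qed
  have "(\<lambda>j. ?f (2 * j)) sums green a (0, 0)"
    using s odd by (subst sums_mono_reindex) (auto simp: strict_mono_def)
  then have "(\<lambda>j. (4 + a) * ?f (2 * j)) sums ((4 + a) * green a (0, 0))"
    by (rule sums_mult)
  moreover have "(4 + a) * ?f (2 * j) = (central_weight j)\<^sup>2 * ((4 / (4 + a))\<^sup>2) ^ j" for j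
  proof -
    have "line_walks (2 * j) 0 = real ((2 * j) choose j)"
      using line_walks_binomial[of "2 * j" j] by simp
    then have "walks (2 * j) (0, 0) = (real ((2 * j) choose j))\<^sup>2"
      by (simp add: walks_eq_line_walks power2_eq_square)
    moreover have "((4 / (4 + a))\<^sup>2) ^ j = (4 ^ j)\<^sup>2 / (4 + a) ^ (2 * j)"
      by (simp only: power_divide power_mult[symmetric] mult.commute[of 2 j])
    ultimately show ?thesis using assms
      by (simp add: central_weight_def power_divide)
  qed
  ultimately show ?thesis by simp
qed

lemma green_origin_le:
  assumes "a > 0"
  shows "green a (0, 0) \<le> 1 / a"
  using walk_green_sum_le[OF assms, of "{(0, 0)}"] green_eq_walk_green[OF assms] by simp

section \<open>The complete elliptic integral\<close>

lemma central_weight_0: "central_weight 0 = 1"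
  by (simp add: central_weight_def)

lemma central_weight_Suc:
  "central_weight (Suc j) = central_weight j * (2 * real j + 1) / (2 * real j + 2)"
proof -
  have eq: "central_weight i = fact (2 * i) / (fact i * fact i * 4 ^ i)" for i
    unfolding central_weight_def by (subst binomial_fact) auto
  have 1: "(fact (2 * Suc j) :: real) = (2 * real j + 2) * ((2 * real j + 1) * fact (2 * j))"
    by (simp add: algebra_simps)
  have 2: "(fact (Suc j) :: real) = (real j + 1) * fact j" by simp
  have "(2 * real j + 2) * (y * x) / ((real j + 1) * f * ((real j + 1) * f) * (4 * p))
      = x / (f * f * p) * y / (2 * real j + 2)" if "f > 0" "p > 0" for x y f p :: real
  proof -
    have "real j + 1 > 0" by simp
    then show ?thesis using that
      by (simp add: divide_simps) (simp add: algebra_simps)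
  qed
  from this[of "fact j" "4 ^ j"] show ?thesis unfolding eq 1 2 by simp
qed

lemma central_weight_pos: "central_weight j > 0"
  by (simp add: central_weight_def)

lemma central_weight_le_1: "central_weight j \<le> 1"
proof (induction j)
  case (Suc j)
  have "central_weight j * ((2 * real j + 1) / (2 * real j + 2)) \<le> 1 * 1"
    using Suc central_weight_pos[of j] by (intro mult_mono) auto
  then show ?case by (simp add: central_weight_Suc)
qed (simp add: central_weight_0)

lemma gbinomial_neg_half: "((-1/2 :: real) gchoose j) = (-1) ^ j * central_weight j"
proof (induction j)
  case (Suc j)
  have "((-1/2 :: real) gchoose Suc j) = ((-1/2) gchoose j) * ((-1/2 - real j) / (real j + 1))"
    by (simp add: gbinomial_prod_rev field_simps)
  then show ?case unfolding Suc.IH central_weight_Suc by (simp add: divide_simps) (simp add: algebra_simps)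
qed (simp add: central_weight_0)

text \<open>Newton's binomial series with exponent -1/2, whose coefficients are the central weights
  up to sign.\<close>

lemma inverse_sqrt_sums:
  assumes "\<bar>x\<bar> < 1"
  shows "(\<lambda>j. central_weight j * x ^ j) sums (1 / sqrt (1 - x))"
proof -
  have "(\<lambda>j. ((-1/2 :: real) gchoose j) * (- x) ^ j) sums (1 + - x) powr (-1/2)"
    using assms by (intro gen_binomial_real) simp
  moreover have "((-1/2 :: real) gchoose j) * (- x) ^ j = central_weight j * x ^ j" for j
    unfolding gbinomial_neg_half by (subst (2) power_minus) simp
  moreover have "(1 + - x) powr (-1/2) = 1 / sqrt (1 - x)"
    using assms powr_minus_divide[of "1 - x" "1/2"] by (simp add: powr_half_sqrt)
  ultimately show ?thesis by simp
qed

text \<open>Induction on Wallis' integrals: \<open>t ^ (2 * j + 1) * sqrt (1 - t\<^sup>2)\<close>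
  vanishes at both endpoints, so integrating its derivative relates consecutive moments. The
  derivative is singular at 1, hence the interior form of the fundamental theorem.\<close>

lemma moment_has_integral:
  "((\<lambda>t. t ^ (2 * j) / sqrt (1 - t\<^sup>2)) has_integral (pi / 2 * central_weight j)) {0..1}"
proof (induction j)
  case 0
  have "((\<lambda>t. 1 / sqrt (1 - t\<^sup>2)) has_integral (arcsin 1 - arcsin 0)) {0..1}"
  proof (rule fundamental_theorem_of_calculus_interior)
    show "continuous_on {0..1} arcsin" by (rule continuous_on_subset[OF continuous_on_arcsin']) auto
    fix x :: real assume "x \<in> {0<..<1}"
    then have "(arcsin has_real_derivative inverse (sqrt (1 - x\<^sup>2))) (at x)"
      by (intro DERIV_arcsin) auto
    then show "(arcsin has_vector_derivative 1 / sqrt (1 - x\<^sup>2)) (at x)"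
      by (simp add: has_real_derivative_iff_has_vector_derivative inverse_eq_divide)
  qed simp
  then show ?case by (simp add: central_weight_0)
next
  case (Suc j)
  let ?I = "\<lambda>j t. t ^ (2 * j) / sqrt (1 - t\<^sup>2)"
  let ?h = "\<lambda>t::real. t ^ (2 * j + 1) * sqrt (1 - t\<^sup>2)"
  let ?h' = "\<lambda>t. (2 * real j + 1) * ?I j t - (2 * real j + 2) * ?I (Suc j) t"
  have "(?h' has_integral (?h 1 - ?h 0)) {0..1}"
  proof (rule fundamental_theorem_of_calculus_interior)
    show "continuous_on {0..1} ?h" by (intro continuous_intros)
    fix t :: real assume t: "t \<in> {0<..<1}"
    define s where "s = sqrt (1 - t\<^sup>2)"
    have "t\<^sup>2 < 1" using t by (simp add: power_less_one_iff)
    then have s: "s > 0" "s\<^sup>2 = 1 - t\<^sup>2" by (simp_all add: s_def)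
    \<comment> \<open>At \<open>j = 0\<close> the exponent is truncated to 0, which is harmless
      because the term carries the factor \<open>j\<close>.\<close>
    have p: "t ^ (2 * j) + 2 * real j * t ^ (2 * j - Suc 0) * t = (2 * real j + 1) * t ^ (2 * j)"
      by (cases j) (simp_all add: algebra_simps)
    have "(?h has_real_derivative ((2 * real j + 1) * t ^ (2 * j) * s
        + t ^ (2 * j + 1) * (inverse s / 2 * (- (2 * t))))) (at t)"
      unfolding s_def using \<open>t\<^sup>2 < 1\<close>
      by (auto intro!: derivative_eq_intros simp: p)
    moreover have "(2 * real j + 1) * t ^ (2 * j) * s
        + t ^ (2 * j + 1) * (inverse s / 2 * (- (2 * t))) = ?h' t"
    proof -
      have "(2 * real j + 1) * t ^ (2 * j) * s = (2 * real j + 1) * t ^ (2 * j) * (1 - t\<^sup>2) / s"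
        unfolding s(2)[symmetric] using s(1) by (simp add: power2_eq_square)
      moreover have "t ^ (2 * j + 1) * (inverse s / 2 * (- (2 * t))) = - (t ^ (2 * j) * t\<^sup>2) / s"
        by (simp add: field_simps power2_eq_square)
      moreover have "?h' t = ((2 * real j + 1) * t ^ (2 * j) - (2 * real j + 2) * (t ^ (2 * j) * t\<^sup>2)) / s"
        by (simp add: s_def diff_divide_distrib power2_eq_square)
      ultimately show ?thesis by (simp add: add_divide_distrib[symmetric] diff_divide_distrib[symmetric])
          (simp add: algebra_simps)
    qed
    ultimately show "(?h has_vector_derivative ?h' t) (at t)"
      by (simp add: has_real_derivative_iff_has_vector_derivative)
  qed simp
  then have h: "(?h' has_integral 0) {0..1}" by simp
  \<comment> \<open>Solving for the next moment writes its integrand in terms of functions known to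
    be integrable, so integrability comes along with the value.\<close>
  have "((\<lambda>t. ((2 * real j + 1) * ?I j t - ?h' t) / (2 * real j + 2)) has_integral
      (((2 * real j + 1) * (pi / 2 * central_weight j) - 0) / (2 * real j + 2))) {0..1}"
    by (intro has_integral_divide has_integral_diff has_integral_mult_right Suc h)
  moreover have "((2 * real j + 1) * ?I j t - ?h' t) / (2 * real j + 2) = ?I (Suc j) t" for t
  proof -
    have "(c * x - (c * x - d * y)) / d = y" if "d \<noteq> 0" for c d x y :: real using that by simp
    from this[of "2 * real j + 2"] show ?thesis by simp
  qed
  ultimately show ?case by (simp add: central_weight_Suc field_simps)
qed

section \<open>The power series of the elliptic integral\<close>

definition weight_series :: "real \<Rightarrow> real" where
  "weight_series x = (\<Sum>j. (central_weight j)\<^sup>2 * x ^ j)"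

lemma weight_series_summable:
  assumes "\<bar>x\<bar> < 1"
  shows "summable (\<lambda>j. (central_weight j)\<^sup>2 * x ^ j)"
proof (rule summable_comparison_test')
  show "summable (\<lambda>j. \<bar>x\<bar> ^ j)" using assms by (intro summable_geometric) simp
  have "(central_weight j)\<^sup>2 \<le> 1" for j
    using central_weight_le_1[of j] central_weight_pos[of j] by (simp add: power_le_one)
  then show "norm ((central_weight j)\<^sup>2 * x ^ j) \<le> \<bar>x\<bar> ^ j" for j
    using mult_right_mono[of "(central_weight j)\<^sup>2" 1 "\<bar>x\<bar> ^ j"]
    by (simp add: abs_mult power_abs)
qed

lemma weight_series_sums:
  "\<bar>x\<bar> < 1 \<Longrightarrow> (\<lambda>j. (central_weight j)\<^sup>2 * x ^ j) sums weight_series x"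
  unfolding weight_series_def by (intro summable_sums weight_series_summable)

text \<open>Expand the factor \<open>1 / sqrt (1 - k\<^sup>2 * t\<^sup>2)\<close> in its binomial
  series and integrate term by term. All terms are nonnegative, so monotone convergence
  applies.\<close>

lemma elliptic_K_eq:
  assumes "0 \<le> k" "k < 1"
  shows "elliptic_K k = pi / 2 * weight_series (k\<^sup>2)"
proof -
  let ?I = "\<lambda>j t. t ^ (2 * j) / sqrt (1 - t\<^sup>2)"
  let ?f = "\<lambda>N t. \<Sum>j<N. central_weight j * (k\<^sup>2) ^ j * ?I j t"
  let ?x = "\<lambda>N. \<Sum>j<N. central_weight j * (k\<^sup>2) ^ j * (pi / 2 * central_weight j)"
  have k: "\<bar>k\<^sup>2\<bar> < 1" using assms by (simp add: power_less_one_iff)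
  have "((\<lambda>t. 1 / sqrt ((1 - t\<^sup>2) * (1 - k\<^sup>2 * t\<^sup>2))) has_integral pi / 2 * weight_series (k\<^sup>2)) {0..1}"
  proof (rule has_integral_monotone_convergence_increasing)
    show "(?f N has_integral ?x N) {0..1}" for N
      by (intro has_integral_sum has_integral_mult_right moment_has_integral) auto
  next
    fix N and t :: real assume "t \<in> {0..1}"
    then have "0 \<le> ?I N t" by (auto simp: power_le_one)
    then have "0 \<le> central_weight N * (k\<^sup>2) ^ N * ?I N t"
      using central_weight_pos[of N] by (intro mult_nonneg_nonneg) auto
    then show "?f N t \<le> ?f (Suc N) t" by simp
  next
    fix t :: real assume t: "t \<in> {0..1}"
    show "(\<lambda>N. ?f N t) \<longlonglongrightarrow> 1 / sqrt ((1 - t\<^sup>2) * (1 - k\<^sup>2 * t\<^sup>2))"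
    \<comment> \<open>At \<open>t = 1\<close> both the partial sums and the limit are 0, since
      division by 0 gives 0.\<close>
    proof (cases "t = 1")
      case False
      then have "t\<^sup>2 < 1" using t by (simp add: power_less_one_iff)
      then have "k\<^sup>2 * t\<^sup>2 < 1" using k mult_mono[of "k\<^sup>2" "k\<^sup>2" "t\<^sup>2" 1] by simp
      then have "(\<lambda>j. central_weight j * (k\<^sup>2 * t\<^sup>2) ^ j) sums (1 / sqrt (1 - k\<^sup>2 * t\<^sup>2))"
        by (intro inverse_sqrt_sums) simp
      then have "(\<lambda>j. central_weight j * (k\<^sup>2 * t\<^sup>2) ^ j / sqrt (1 - t\<^sup>2))
          sums (1 / sqrt (1 - k\<^sup>2 * t\<^sup>2) / sqrt (1 - t\<^sup>2))" by (rule sums_divide)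
      moreover have "central_weight j * (k\<^sup>2 * t\<^sup>2) ^ j / sqrt (1 - t\<^sup>2)
          = central_weight j * (k\<^sup>2) ^ j * ?I j t" for j
        by (simp only: power_mult_distrib power_mult) simp
      moreover have "1 / sqrt (1 - k\<^sup>2 * t\<^sup>2) / sqrt (1 - t\<^sup>2)
          = 1 / sqrt ((1 - t\<^sup>2) * (1 - k\<^sup>2 * t\<^sup>2))"
        by (simp add: real_sqrt_mult)
      ultimately show ?thesis unfolding sums_def by (simp only:)
    qed simp
  next
    have S: "(\<lambda>j. pi / 2 * ((central_weight j)\<^sup>2 * (k\<^sup>2) ^ j)) sums (pi / 2 * weight_series (k\<^sup>2))"
      by (intro sums_mult weight_series_sums k)
    have eq: "pi / 2 * ((central_weight j)\<^sup>2 * (k\<^sup>2) ^ j)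
        = central_weight j * (k\<^sup>2) ^ j * (pi / 2 * central_weight j)" for j
      by (simp add: power2_eq_square)
    show "?x \<longlonglongrightarrow> pi / 2 * weight_series (k\<^sup>2)"
      using S unfolding sums_def eq .
  qed
  then show ?thesis unfolding elliptic_K_def by (rule integral_unique)
qed

lemma green_origin_eq:
  assumes "a > 0"
  shows "green a (0, 0) = weight_series ((4 / (4 + a))\<^sup>2) / (4 + a)"
proof -
  have "((4 / (4 + a))\<^sup>2) < 1" using assms by (simp add: power_less_one_iff)
  then have "(4 + a) * green a (0, 0) = weight_series ((4 / (4 + a))\<^sup>2)"
    by (intro sums_unique2[OF green_origin_sums[OF assms]] weight_series_sums) simp
  then show ?thesis using assms by (simp add: field_simps)
qed

lemma green_origin_elliptic:
  assumes "a > 0"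
  shows "green a (0, 0) = 2 / pi * (elliptic_K (4 / (4 + a)) / (4 + a))"
proof -
  have E: "elliptic_K (4 / (4 + a)) = pi / 2 * weight_series ((4 / (4 + a))\<^sup>2)"
    using assms by (intro elliptic_K_eq) auto
  have "w / d = 2 / pi * (pi / 2 * w / d)" for w d by simp
  then show ?thesis unfolding green_origin_eq[OF assms] E .
qed

section \<open>Wallis' bounds and the logarithmic growth of the series\<close>

lemma wallis_central_weight_Suc:
  "(central_weight (Suc n))\<^sup>2 * (2 * real (Suc n) + 1) = (central_weight n)\<^sup>2 * (2 * real n + 1)
    * ((2 * real n + 1) * (2 * real n + 3) / (2 * real n + 2)\<^sup>2)"
  by (simp add: central_weight_Suc power_divide power_mult_distrib)
    (simp add: power2_eq_square algebra_simps)

text \<open>This recognises the reciprocals of the partial Wallis products, from which the limit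
  \<open>2 / pi\<close> follows.\<close>

lemma wallis_central_weight:
  "(central_weight n)\<^sup>2 * (2 * real n + 1) = inverse (\<Prod>k=1..n. (4 * real k ^ 2) / (4 * real k ^ 2 - 1))"
proof (induction n)
  case (Suc n)
  have "(2 * real n + 1) * (2 * real n + 3) = 4 * real (Suc n) ^ 2 - 1"
    "(2 * real n + 2)\<^sup>2 = 4 * real (Suc n) ^ 2"
    by (simp_all add: power2_eq_square algebra_simps)
  then have "(2 * real n + 1) * (2 * real n + 3) / (2 * real n + 2)\<^sup>2
      = inverse ((4 * real (Suc n) ^ 2) / (4 * real (Suc n) ^ 2 - 1))" by simp
  then show ?case
    unfolding wallis_central_weight_Suc Suc.IH
    by (simp only: prod.nat_ivl_Suc' inverse_mult_distrib mult.commute)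
qed (simp add: central_weight_0)

lemma wallis_limit: "(\<lambda>n. (central_weight n)\<^sup>2 * (2 * real n + 1)) \<longlonglongrightarrow> 2 / pi"
  unfolding wallis_central_weight using tendsto_inverse[OF wallis] by simp

text \<open>The sequence in \<open>wallis_limit\<close> is decreasing and therefore stays above its
  limit; then \<open>2 n + 1\<close> is replaced by \<open>2 n + 2\<close>.\<close>

lemma central_weight_sq_ge: "(central_weight n)\<^sup>2 \<ge> 1 / (pi * (real n + 1))"
proof -
  have "decseq (\<lambda>n. (central_weight n)\<^sup>2 * (2 * real n + 1))"
  proof (rule decseq_SucI)
    fix n
    have "(2 * real n + 1) * (2 * real n + 3) \<le> (2 * real n + 2)\<^sup>2"
      by (simp add: power2_eq_square algebra_simps)
    then have "(central_weight n)\<^sup>2 * (2 * real n + 1)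
        * ((2 * real n + 1) * (2 * real n + 3) / (2 * real n + 2)\<^sup>2)
        \<le> (central_weight n)\<^sup>2 * (2 * real n + 1) * 1"
      by (intro mult_left_mono) (simp_all add: divide_le_eq_1)
    then show "(central_weight (Suc n))\<^sup>2 * (2 * real (Suc n) + 1) \<le> (central_weight n)\<^sup>2 * (2 * real n + 1)"
      unfolding wallis_central_weight_Suc by simp
  qed
  then have "2 / pi \<le> (central_weight n)\<^sup>2 * (2 * real n + 1)"
    using wallis_limit by (rule decseq_ge)
  also have "\<dots> \<le> (central_weight n)\<^sup>2 * (2 * (real n + 1))" by (intro mult_left_mono) auto
  finally have "1 \<le> (central_weight n)\<^sup>2 * (pi * (real n + 1))" by (simp add: field_simps)
  then show ?thesis by (subst pos_divide_le_eq) simp_all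
qed

text \<open>With the factor \<open>n\<close> in place of \<open>2 n + 1\<close> the sequence
  increases, so its limit \<open>1 / pi\<close> is an upper bound.\<close>

lemma central_weight_sq_le:
  assumes "n > 0"
  shows "(central_weight n)\<^sup>2 \<le> 1 / (pi * real n)"
proof -
  have "incseq (\<lambda>n. (central_weight n)\<^sup>2 * real n)"
  proof (rule incseq_SucI)
    fix n
    define y where "y = real n"
    have "y \<ge> 0" by (simp add: y_def)
    \<comment> \<open>The comparison amounts to
      \<open>4 * y * (y + 1) \<le> (2 * y + 1)\<^sup>2\<close>.\<close>
    have "(central_weight n)\<^sup>2 * y \<le> (central_weight n)\<^sup>2 * ((2 * y + 1)\<^sup>2 / (4 * (y + 1)))"
      using \<open>y \<ge> 0\<close> by (intro mult_left_mono) (simp_all add: power2_eq_square field_simps)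
    also have "\<dots> = (central_weight (Suc n))\<^sup>2 * real (Suc n)"
    proof -
      have "2 * y + 2 = 2 * (y + 1)" "real (Suc n) = y + 1" by (simp_all add: y_def)
      then show ?thesis using \<open>y \<ge> 0\<close> unfolding central_weight_Suc y_def[symmetric]
        by (simp add: power2_eq_square divide_simps) (simp add: algebra_simps)
    qed
    finally show "(central_weight n)\<^sup>2 * real n \<le> (central_weight (Suc n))\<^sup>2 * real (Suc n)"
      by (simp add: y_def)
  qed
  moreover have "(\<lambda>n. (central_weight n)\<^sup>2 * real n) \<longlonglongrightarrow> 1 / pi"
  proof -
    have "(\<lambda>n. real n / (2 * real n + 1)) \<longlonglongrightarrow> 1 / 2" by real_asymp
    then have "(\<lambda>n. (central_weight n)\<^sup>2 * (2 * real n + 1) * (real n / (2 * real n + 1))) \<longlonglongrightarrow> 2 / pi * (1 / 2)"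
      by (intro tendsto_mult wallis_limit)
    moreover have "(central_weight n)\<^sup>2 * (2 * real n + 1) * (real n / (2 * real n + 1)) = (central_weight n)\<^sup>2 * real n" for n
      by simp
    ultimately show ?thesis by simp
  qed
  ultimately have "(central_weight n)\<^sup>2 * real n \<le> 1 / pi" by (rule incseq_le)
  then show ?thesis using assms by (simp add: field_simps)
qed

text \<open>Termwise comparison with the logarithmic series divided by \<open>pi\<close>. The lower
  bound on the weights has \<open>n + 1\<close> in the denominator, so there the series is shifted
  by one and an extra factor \<open>x \<le> 1\<close> is given away.\<close>

lemma weight_series_bounds:
  assumes "0 \<le> x" "x < 1"
  shows "- ln (1 - x) / pi \<le> weight_series x" "weight_series x \<le> 1 - ln (1 - x) / pi"
proof -
  have "(\<lambda>n. - ((- (- x)) ^ n) / of_nat n) sums ln (1 + - x)"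
    using assms by (intro ln_series') simp
  then have "(\<lambda>n. x ^ n / real n * (-1)) sums ln (1 - x)" by simp
  then have "(\<lambda>n. x ^ n / real n * (-1) * (-1)) sums (ln (1 - x) * (-1))" by (rule sums_mult2)
  then have "(\<lambda>n. x ^ n / real n) sums (- ln (1 - x))" by simp
  then have L: "(\<lambda>n. x ^ n / real n / pi) sums (- ln (1 - x) / pi)" by (rule sums_divide)
  have W: "(\<lambda>j. (central_weight j)\<^sup>2 * x ^ j) sums weight_series x"
    using assms by (intro weight_series_sums) simp
  have L': "(\<lambda>n. x ^ Suc n / real (Suc n) / pi) sums (- ln (1 - x) / pi)"
    using L by (subst sums_Suc_iff) simp
  have "x ^ Suc n / real (Suc n) / pi \<le> (central_weight n)\<^sup>2 * x ^ n" for n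
  proof -
    have "x ^ Suc n / real (Suc n) / pi = 1 / (pi * (real n + 1)) * x ^ Suc n"
      by (simp add: field_simps)
    also have "\<dots> \<le> (central_weight n)\<^sup>2 * x ^ n"
      using central_weight_sq_ge[of n] assms power_Suc_le_self[of x n]
      by (intro mult_mono) (auto simp: mult_left_le_one_le)
    finally show ?thesis .
  qed
  then show "- ln (1 - x) / pi \<le> weight_series x" using L' W by (rule sums_le)
  \<comment> \<open>The term of index 0 of the logarithmic series is 0 by the convention for
    division; the added 1 covers the weight there.\<close>
  have L'': "(\<lambda>n. (if n = 0 then 1 else 0) + x ^ n / real n / pi) sums (1 + - ln (1 - x) / pi)"
    using sums_single[of 0 "\<lambda>_. 1 :: real"] by (intro sums_add L) simp
  have "(central_weight n)\<^sup>2 * x ^ n \<le> (if n = 0 then 1 else 0) + x ^ n / real n / pi" for n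
  proof (cases "n = 0")
    case False
    then show ?thesis
      using mult_right_mono[OF central_weight_sq_le[of n], of "x ^ n"] assms by (simp add: mult.commute)
  qed (simp add: central_weight_0)
  then have "weight_series x \<le> 1 + - ln (1 - x) / pi" using W L'' by (rule sums_le)
  then show "weight_series x \<le> 1 - ln (1 - x) / pi" by simp
qed

section \<open>Uniqueness of the maximiser\<close>

definition weight_deriv :: "real \<Rightarrow> real" where
  "weight_deriv x = (\<Sum>j. diffs (\<lambda>j. (central_weight j)\<^sup>2) j * x ^ j)"

lemma weight_deriv_summable:
  assumes "\<bar>x\<bar> < 1"
  shows "summable (\<lambda>j. diffs (\<lambda>j. (central_weight j)\<^sup>2) j * x ^ j)"
  using assms by (intro termdiff_converges[where K = 1] weight_series_summable) auto

lemma weight_series_has_derivative: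
  assumes "\<bar>x\<bar> < 1"
  shows "(weight_series has_real_derivative weight_deriv x) (at x)"
  unfolding weight_series_def[abs_def] weight_deriv_def
  using assms by (intro termdiffs_strong'[where K = 1] weight_series_summable) auto

lemma weight_deriv_isCont:
  assumes "\<bar>x\<bar> < 1"
  shows "isCont weight_deriv x"
  unfolding weight_deriv_def[abs_def]
  by (rule DERIV_isCont, rule termdiffs_strong'[where K = 1])
    (use assms weight_deriv_summable in auto)

lemma weight_series_ge_1:
  assumes "0 \<le> x" "x < 1"
  shows "weight_series x \<ge> 1"
proof -
  have "(\<Sum>j<1. (central_weight j)\<^sup>2 * x ^ j) \<le> weight_series x"
    unfolding weight_series_def using assms by (intro sum_le_suminf weight_series_summable) auto
  then show ?thesis by (simp add: central_weight_0)
qed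

lemma weight_deriv_nonneg:
  assumes "0 \<le> x" "x < 1"
  shows "weight_deriv x \<ge> 0"
  unfolding weight_deriv_def
  using assms by (intro suminf_nonneg weight_deriv_summable) (auto simp: diffs_def)

lemma weight_series_mono:
  assumes "0 \<le> x" "x \<le> y" "y < 1"
  shows "weight_series x \<le> weight_series y"
  unfolding weight_series_def
  using assms by (intro suminf_le weight_series_summable mult_left_mono power_mono) auto

text \<open>Up to the factor \<open>\<pi> / 2\<close>, \<open>second_kind (k\<^sup>2)\<close> is the complete elliptic integral of the second
  kind \<open>E(k) = (1 - k\<^sup>2) d(k K(k))/dk\<close>, whose power series has negative coefficients beyond the
  constant term.\<close>

definition second_kind :: "real \<Rightarrow> real" where
  "second_kind x = (1 - x) * (weight_series x + 2 * x * weight_deriv x)"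

text \<open>The bracket in \<open>second_kind\<close> has coefficients \<open>(2 n + 1) q\<close>
  with \<open>q\<close> the squared weight; multiplying by \<open>1 - x\<close> takes consecutive
  differences, which Wallis' recursion evaluates. Their constant sign makes
  \<open>second_kind\<close> decreasing.\<close>

lemma second_kind_sums:
  assumes "\<bar>x\<bar> < 1"
  shows "(\<lambda>n. (central_weight n)\<^sup>2 * (2 * real n + 1) / (2 * real n + 2)\<^sup>2 * x ^ Suc n)
    sums (1 - second_kind x)"
proof -
  let ?q = "\<lambda>n. (central_weight n)\<^sup>2"
  let ?T = "weight_series x + 2 * x * weight_deriv x"
  have "(\<lambda>n. 2 * x * (diffs ?q n * x ^ n)) sums (2 * x * weight_deriv x)"
    unfolding weight_deriv_def by (intro sums_mult summable_sums weight_deriv_summable assms)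
  moreover have "2 * x * (diffs ?q n * x ^ n) = 2 * real (Suc n) * ?q (Suc n) * x ^ Suc n" for n
    by (simp only: diffs_def power_Suc mult_ac)
  ultimately have "(\<lambda>n. 2 * real (Suc n) * ?q (Suc n) * x ^ Suc n) sums (2 * x * weight_deriv x)"
    by (simp only:)
  then have "(\<lambda>n. 2 * real n * ?q n * x ^ n) sums (2 * x * weight_deriv x)"
    by (subst (asm) sums_Suc_iff) simp
  then have "(\<lambda>n. ?q n * x ^ n + 2 * real n * ?q n * x ^ n) sums ?T"
    by (intro sums_add weight_series_sums assms)
  then have T: "(\<lambda>n. (2 * real n + 1) * ?q n * x ^ n) sums ?T"
    by (simp add: algebra_simps)
  then have "(\<lambda>n. (2 * real (Suc n) + 1) * ?q (Suc n) * x ^ Suc n) sums (?T - 1)"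
    by (subst sums_Suc_iff) (simp add: central_weight_0)
  \<comment> \<open>Multiplication by \<open>1 - x\<close>: the series times \<open>x\<close> minus
    the series itself, whose constant term 1 has been split off to align the powers.\<close>
  then have "(\<lambda>n. x * ((2 * real n + 1) * ?q n * x ^ n) - (2 * real (Suc n) + 1) * ?q (Suc n) * x ^ Suc n)
      sums (x * ?T - (?T - 1))"
    by (intro sums_diff sums_mult T)
  moreover have "x * ((2 * real n + 1) * ?q n * x ^ n) - (2 * real (Suc n) + 1) * ?q (Suc n) * x ^ Suc n
      = ?q n * (2 * real n + 1) / (2 * real n + 2)\<^sup>2 * x ^ Suc n" for n
  proof -
    have 1: "(2 * real n + 1) * (2 * real n + 3) = (2 * real n + 2)\<^sup>2 - 1"
      by (simp add: power2_eq_square algebra_simps)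
    have 2: "(2 * real n + 2)\<^sup>2 \<noteq> 0" by simp
    have 3: "(2 * real (Suc n) + 1) * ?q (Suc n) = ?q n * (2 * real n + 1) * (1 - 1 / (2 * real n + 2)\<^sup>2)"
      using wallis_central_weight_Suc[of n] 2 unfolding 1
      by (simp add: diff_divide_distrib mult.commute)
    show ?thesis unfolding 3 by (simp add: algebra_simps add_divide_distrib)
  qed
  moreover have "x * ?T - (?T - 1) = 1 - second_kind x"
    by (simp add: second_kind_def algebra_simps)
  ultimately show ?thesis by simp
qed

lemma second_kind_antimono:
  assumes "0 \<le> x" "x \<le> y" "y < 1"
  shows "second_kind y \<le> second_kind x"
proof -
  have "1 - second_kind x \<le> 1 - second_kind y"
  proof (rule sums_le[OF _ second_kind_sums second_kind_sums])
    show "(central_weight n)\<^sup>2 * (2 * real n + 1) / (2 * real n + 2)\<^sup>2 * x ^ Suc n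
      \<le> (central_weight n)\<^sup>2 * (2 * real n + 1) / (2 * real n + 2)\<^sup>2 * y ^ Suc n" for n
      using assms by (intro mult_left_mono power_mono) auto
  qed (use assms in auto)
  then show ?thesis by simp
qed

lemma second_kind_0: "second_kind 0 = 1"
  using weight_series_sums[of 0] sums_unique2[OF weight_series_sums[of 0] powser_sums_zero]
  by (simp add: second_kind_def central_weight_0)

lemma second_kind_pos:
  assumes "0 \<le> x" "x < 1"
  shows "second_kind x > 0"
proof -
  have "weight_series x + 2 * x * weight_deriv x > 0"
    using weight_series_ge_1[OF assms] weight_deriv_nonneg[OF assms] assms
    by (intro add_pos_nonneg) auto
  then show ?thesis using assms by (simp add: second_kind_def)
qed

section \<open>The critical point equation in the elliptic modulus\<close>

text \<open>This is \<open>E(k) / ((1 + k) K(k))\<close>, the factors \<open>pi / 2\<close>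
  cancelling. Critical points of \<open>log_profile \<theta>\<close> are the \<open>k\<close> at
  which it equals \<open>\<theta>\<close>.\<close>

definition log_slope :: "real \<Rightarrow> real" where
  "log_slope k = second_kind (k\<^sup>2) / ((1 + k) * weight_series (k\<^sup>2))"

text \<open>The positive numerator does not increase and the denominator does not decrease; the
  factor \<open>1 + k\<close> makes the monotonicity strict.\<close>

lemma log_slope_strict_antimono:
  assumes "0 \<le> k" "k < l" "l < 1"
  shows "log_slope l < log_slope k"
proof -
  have sq: "0 \<le> k\<^sup>2" "k\<^sup>2 \<le> l\<^sup>2" "l\<^sup>2 < 1" "k\<^sup>2 < 1"
    using assms by (auto simp: power_less_one_iff intro!: power_mono)
  have W: "1 \<le> weight_series (k\<^sup>2)" "weight_series (k\<^sup>2) \<le> weight_series (l\<^sup>2)"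
    using sq by (auto intro!: weight_series_ge_1 weight_series_mono)
  have "(1 + k) * weight_series (k\<^sup>2) < (1 + l) * weight_series (k\<^sup>2)"
    using assms W by (intro mult_strict_right_mono) auto
  also have "\<dots> \<le> (1 + l) * weight_series (l\<^sup>2)"
    using assms W by (intro mult_left_mono) auto
  finally have D: "(1 + k) * weight_series (k\<^sup>2) < (1 + l) * weight_series (l\<^sup>2)" .
  have "0 < (1 + k) * weight_series (k\<^sup>2)" using W assms by (intro mult_pos_pos) auto
  then show ?thesis unfolding log_slope_def
    using D second_kind_antimono[of "k\<^sup>2" "l\<^sup>2"] second_kind_pos[of "l\<^sup>2"] sq
    by (intro frac_less2) auto
qed

lemma log_slope_isCont:
  assumes "0 \<le> k" "k < 1"
  shows "isCont log_slope k"
proof -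
  have k: "k\<^sup>2 < 1" using assms by (simp add: power_less_one_iff)
  have W: "isCont (\<lambda>k. weight_series (k\<^sup>2)) k"
    by (rule isCont_o2[where f = "\<lambda>k. k\<^sup>2" and g = weight_series])
      (use k in \<open>simp_all add: DERIV_isCont[OF weight_series_has_derivative]\<close>)
  have D: "isCont (\<lambda>k. weight_deriv (k\<^sup>2)) k"
    by (rule isCont_o2[where f = "\<lambda>k. k\<^sup>2" and g = weight_deriv])
      (use k in \<open>simp_all add: weight_deriv_isCont\<close>)
  have "weight_series (k\<^sup>2) \<noteq> 0" using weight_series_ge_1[of "k\<^sup>2"] k by auto
  then show ?thesis unfolding log_slope_def[abs_def] second_kind_def
    using assms by (intro continuous_intros W D) auto
qed

lemma log_slope_eq_ex:
  assumes "0 < \<theta>" "\<theta> < 1"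
  obtains k where "0 < k" "k < 1" "log_slope k = \<theta>"
proof -
  \<comment> \<open>Chosen so that the logarithmic lower bound for \<open>weight_series x\<close> is
    exactly \<open>2 / \<theta>\<close>; this pushes the slope down to at most
    \<open>\<theta> / 2\<close>, while it is 1 at \<open>k = 0\<close>.\<close>
  define x where "x = 1 - exp (- 2 * pi / \<theta>)"
  have x: "0 < x" "x < 1" using assms by (auto simp: x_def)
  define l where "l = sqrt x"
  have l: "0 < l" "l < 1" "l\<^sup>2 = x" using x by (auto simp: l_def real_sqrt_lt_1_iff)
  have "2 / \<theta> \<le> weight_series x"
    using weight_series_bounds(1)[of x] x by (simp add: x_def)
  also have "\<dots> \<le> (1 + l) * weight_series x"
    using weight_series_ge_1[of x] x l by (simp add: mult_le_cancel_right1)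
  finally have den: "2 / \<theta> \<le> (1 + l) * weight_series x" .
  have num: "second_kind x \<le> 1" using second_kind_antimono[of 0 x] x by (simp add: second_kind_0)
  have "log_slope l \<le> 1 / (2 / \<theta>)"
    unfolding log_slope_def l(3) using num den assms by (intro frac_le) auto
  then have "log_slope l < \<theta>" using assms by simp
  moreover have W0: "weight_series 0 = 1"
    using second_kind_0 by (simp add: second_kind_def)
  then have s0: "log_slope 0 = 1" by (simp add: log_slope_def second_kind_0)
  ultimately obtain k where k: "0 \<le> k" "k \<le> l" "log_slope k = \<theta>"
    using IVT2[of log_slope l \<theta> 0] log_slope_isCont l assms by force
  then have "k \<noteq> 0" using s0 assms by auto
  then show thesis using k l that[of k] by auto
qed

text \<open>The logarithm of \<open>profile \<theta> a\<close> in the variable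
  \<open>k = 4 / (4 + a)\<close>, where \<open>a = 4 * (1 - k) / k\<close> and
  \<open>4 + a = 4 / k\<close>.\<close>

definition log_profile :: "real \<Rightarrow> real \<Rightarrow> real" where
  "log_profile \<theta> k = \<theta> * (ln 4 + ln (1 - k) - ln k) + (ln k - ln 4) + ln (weight_series (k\<^sup>2))"

lemma log_profile_has_derivative:
  assumes "0 < k" "k < 1"
  shows "(log_profile \<theta> has_real_derivative (log_slope k - \<theta>) / (k * (1 - k))) (at k)"
proof -
  define W where "W = weight_series (k\<^sup>2)"
  define D where "D = weight_deriv (k\<^sup>2)"
  have k: "\<bar>k\<^sup>2\<bar> < 1" using assms by (simp add: power_less_one_iff)
  have W1: "W > 0" using weight_series_ge_1[of "k\<^sup>2"] k by (auto simp: W_def)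
  have "((\<lambda>k. weight_series (k\<^sup>2)) has_real_derivative D * (2 * k)) (at k)"
    unfolding D_def by (rule DERIV_chain2[where f = weight_series and g = "\<lambda>k. k\<^sup>2", OF weight_series_has_derivative[OF k]]) (auto intro!: derivative_eq_intros)
  then have "((\<lambda>k. ln (weight_series (k\<^sup>2))) has_real_derivative 1 / W * (D * (2 * k))) (at k)"
    using W1 unfolding W_def
    by (intro DERIV_chain2[where f = ln and g = "\<lambda>k. weight_series (k\<^sup>2)"] DERIV_ln_divide)
  moreover have "((\<lambda>k. \<theta> * (ln 4 + ln (1 - k) - ln k) + (ln k - ln 4)) has_real_derivative
      \<theta> * (- 1 / (1 - k) - 1 / k) + 1 / k) (at k)"
    using assms by (auto intro!: derivative_eq_intros)
  ultimately have "(log_profile \<theta> has_real_derivative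
      \<theta> * (- 1 / (1 - k) - 1 / k) + 1 / k + 1 / W * (D * (2 * k))) (at k)"
    unfolding log_profile_def[abs_def] by (rule DERIV_add[rotated])
  moreover have "\<theta> * (- 1 / (1 - k) - 1 / k) + 1 / k + 1 / W * (D * (2 * k))
      = (log_slope k - \<theta>) / (k * (1 - k))"
  proof -
    have "- 1 / (1 - k) - 1 / k = - 1 / (k * (1 - k))"
      using assms by (simp add: divide_simps)
    \<comment> \<open>The factor \<open>1 - k\<^sup>2\<close> of \<open>second_kind\<close> splits,
      and \<open>1 + k\<close> cancels against the denominator of \<open>log_slope\<close>.\<close>
    moreover have "log_slope k = (1 - k) * (W + 2 * k\<^sup>2 * D) / W"
    proof -
      have "1 - k\<^sup>2 = (1 - k) * (1 + k)" by (simp add: power2_eq_square algebra_simps)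
      then show ?thesis using assms
        by (simp add: log_slope_def second_kind_def W_def D_def)
    qed
    moreover have "((1 - k) * (W + 2 * k\<^sup>2 * D) / W) / (k * (1 - k)) = 1 / k + 1 / W * (D * (2 * k))"
      using assms W1 by (simp add: power2_eq_square divide_simps)
    ultimately show ?thesis by (simp add: diff_divide_distrib)
  qed
  ultimately show ?thesis by simp
qed

text \<open>The derivative has the sign of \<open>log_slope - \<theta>\<close>, which by strict
  monotonicity is positive to the left of \<open>k\<close> and negative to the right.\<close>

lemma log_profile_strict_max:
  assumes k: "0 < k" "k < 1" "log_slope k = \<theta>" and l: "0 < l" "l < 1" "l \<noteq> k"
  shows "log_profile \<theta> l < log_profile \<theta> k"
proof (cases "l < k")
  case True
  show ?thesis
  proof (rule DERIV_pos_imp_increasing_open[OF True])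
    fix x assume x: "l < x" "x < k"
    have "log_slope x > \<theta>" using log_slope_strict_antimono[of x k] x k l by simp
    then show "\<exists>y. (log_profile \<theta> has_real_derivative y) (at x) \<and> 0 < y"
      using x l k log_profile_has_derivative[of x \<theta>]
        divide_pos_pos[of "log_slope x - \<theta>" "x * (1 - x)"] by fastforce
  next
    show "continuous_on {l..k} (log_profile \<theta>)"
      using l k by (intro continuous_at_imp_continuous_on ballI DERIV_isCont[OF log_profile_has_derivative]) auto
  qed
next
  case False
  then have "k < l" using l by simp
  then show ?thesis
  proof (rule DERIV_neg_imp_decreasing_open)
    fix x assume x: "k < x" "x < l"
    have "log_slope x < \<theta>" using log_slope_strict_antimono[of k x] x k l by simp
    then show "\<exists>y. (log_profile \<theta> has_real_derivative y) (at x) \<and> y < 0"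
      using x l k log_profile_has_derivative[of x \<theta>]
        divide_neg_pos[of "log_slope x - \<theta>" "x * (1 - x)"] by fastforce
  next
    show "continuous_on {k..l} (log_profile \<theta>)"
      using l k by (intro continuous_at_imp_continuous_on ballI DERIV_isCont[OF log_profile_has_derivative]) auto
  qed
qed

definition profile :: "real \<Rightarrow> real \<Rightarrow> real" where
  "profile \<theta> a = a powr \<theta> * green a (0, 0)"

lemma profile_eq_exp:
  assumes "a > 0"
  shows "profile \<theta> a = exp (log_profile \<theta> (4 / (4 + a)))"
proof -
  define k where "k = 4 / (4 + a)"
  have k: "0 < k" "k < 1" "4 * (1 - k) / k = a" "green a (0, 0) = k * weight_series (k\<^sup>2) / 4"
    using assms by (simp_all add: k_def green_origin_eq field_simps)
  have "weight_series (k\<^sup>2) \<ge> 1" using k by (intro weight_series_ge_1) (auto simp: power_less_one_iff)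
  then have W: "weight_series (k\<^sup>2) > 0" by simp
  have "ln (4 * (1 - k) / k) = ln 4 + ln (1 - k) - ln k"
    using k(1,2) ln_div[of "4 * (1 - k)" k] ln_mult[of 4 "1 - k"] by simp
  then have "ln a = ln 4 + ln (1 - k) - ln k" unfolding k(3) .
  moreover have "green a (0, 0) = exp ((ln k - ln 4) + ln (weight_series (k\<^sup>2)))"
    using k W by (simp add: exp_add exp_diff)
  ultimately show ?thesis unfolding k_def[symmetric] log_profile_def profile_def
    using assms by (simp add: exp_add powr_def)
qed

text \<open>The map from \<open>a\<close> to \<open>4 / (4 + a)\<close> is injective into (0,1), so
  the strict maximum in \<open>k\<close> carries over.\<close>

lemma profile_unique_max:
  assumes "0 < \<theta>" "\<theta> < 1"
  obtains a where "a > 0" "\<And>b. b > 0 \<Longrightarrow> b \<noteq> a \<Longrightarrow> profile \<theta> b < profile \<theta> a"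
proof -
  obtain k where k: "0 < k" "k < 1" "log_slope k = \<theta>" using log_slope_eq_ex assms by blast
  define a where "a = 4 * (1 - k) / k"
  have a: "a > 0" "4 / (4 + a) = k" using k by (auto simp: a_def field_simps)
  show thesis
  proof (rule that[OF a(1)])
    fix b :: real assume b: "b > 0" "b \<noteq> a"
    have "4 / (4 + b) \<noteq> k"
    proof
      assume "4 / (4 + b) = k"
      then have "b = a" unfolding a_def using b by (auto simp: divide_simps algebra_simps)
      then show False using b by simp
    qed
    then show "profile \<theta> b < profile \<theta> a"
      using b a k by (simp add: profile_eq_exp log_profile_strict_max)
  qed
qed

section \<open>The sharp constant and its asymptotics\<close>

text \<open>Weighted arithmetic-geometric mean of \<open>N / (1 - \<theta>)\<close> and
  \<open>a * M / \<theta>\<close> with weights \<open>1 - \<theta>\<close> and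
  \<open>\<theta>\<close>.\<close>

lemma young_energy:
  fixes \<theta> M N a :: real
  assumes "0 < \<theta>" "\<theta> < 1" "M > 0" "N > 0" "a > 0"
  shows "M powr \<theta> * N powr (1 - \<theta>) / (\<theta> powr \<theta> * (1 - \<theta>) powr (1 - \<theta>)) * a powr \<theta> \<le> N + a * M"
proof -
  have "(N / (1 - \<theta>)) powr (1 - \<theta>) * (a * M / \<theta>) powr \<theta>
      \<le> (1 - \<theta>) * (N / (1 - \<theta>)) + \<theta> * (a * M / \<theta>)"
    using assms by (intro Youngs_inequality_0) auto
  also have "\<dots> = N + a * M" using assms by simp
  finally show ?thesis using assms by (simp add: powr_divide powr_mult mult_ac)
qed

text \<open>The chosen \<open>a\<close> makes the two averaged quantities
  \<open>N / (1 - \<theta>)\<close> and \<open>a * M / \<theta>\<close> coincide, so their means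
  agree.\<close>

lemma young_energy_eq:
  fixes \<theta> M N :: real
  assumes "0 < \<theta>" "\<theta> < 1" "M > 0" "N > 0"
  defines "a \<equiv> \<theta> * N / ((1 - \<theta>) * M)"
  shows "M powr \<theta> * N powr (1 - \<theta>) / (\<theta> powr \<theta> * (1 - \<theta>) powr (1 - \<theta>)) * a powr \<theta> = N + a * M"
proof -
  let ?x = "N / (1 - \<theta>)"
  have aM: "a * M = \<theta> * ?x" using assms(1-4) by (simp add: a_def divide_simps)
  have a: "a > 0" unfolding a_def using assms(1-4) by (intro divide_pos_pos mult_pos_pos) auto
  have "?x powr (1 - \<theta>) * (a * M / \<theta>) powr \<theta> = ?x"
    unfolding aM using assms(1-4) by (simp add: powr_add[symmetric])
  also have "?x = N + a * M" unfolding aM using assms(1-4) by (simp add: divide_simps) (simp add: algebra_simps)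
  finally show ?thesis using assms(1-4) a by (simp add: powr_divide powr_mult mult_ac)
qed

lemma interp_rhs_eq:
  "interp_rhs \<theta> u = (l2_norm u)\<^sup>2 powr \<theta> * (grad_norm u)\<^sup>2 powr (1 - \<theta>)"
proof -
  have "(x\<^sup>2) powr p = x powr (2 * p)" if "x \<ge> 0" for x p :: real
    using that by (simp add: powr_powr[symmetric] powr_numeral)
  moreover have "l2_norm u \<ge> 0" "grad_norm u \<ge> 0"
    by (simp_all add: l2_norm_def grad_norm_def l2_inner_nonneg)
  ultimately show ?thesis by (simp add: interp_rhs_def)
qed

lemma norms_sq_pos:
  assumes "u \<in> l2" "u \<noteq> (\<lambda>x. 0)"
  shows "(l2_norm u)\<^sup>2 > 0" "(grad_norm u)\<^sup>2 > 0"
  using l2_inner_pos[OF assms] grad_norm_pos[OF assms] by (simp_all add: l2_norm_sq)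

lemma is_green_green: "a > 0 \<Longrightarrow> is_green a (green a)"
  by (simp add: green_eq_walk_green is_green_walk_green)

lemma green_origin_pos: "a > 0 \<Longrightarrow> green a (0, 0) > 0"
  using point_eval_bound(1)[OF _ is_green_green delta_l2] by simp

lemma interp_rhs_zero: "interp_rhs \<theta> (\<lambda>x. 0) = 0"
  by (simp add: interp_rhs_def l2_norm_def l2_inner_def)

text \<open>The right-hand side is positive at a nonzero sequence, so one case of equality already
  bounds every admissible constant from below.\<close>

lemma sharp_const_eqI:
  assumes ineq: "interp_ineq \<theta> C"
    and u: "u \<in> l2" "u \<noteq> (\<lambda>x. 0)" "(u (0, 0))\<^sup>2 = C * interp_rhs \<theta> u"
  shows "sharp_const \<theta> = C" "\<And>C'. interp_ineq \<theta> C' \<Longrightarrow> C \<le> C'"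
proof -
  have pos: "interp_rhs \<theta> u > 0"
    using norms_sq_pos[OF u(1,2)] by (simp add: interp_rhs_eq)
  show least: "C \<le> C'" if "interp_ineq \<theta> C'" for C'
  proof -
    have "C * interp_rhs \<theta> u \<le> C' * interp_rhs \<theta> u"
      using that u by (auto simp: interp_ineq_def)
    then show ?thesis using pos by simp
  qed
  show "sharp_const \<theta> = C"
    unfolding sharp_const_def using ineq least by (intro cInf_eq_minimum) auto
qed

section \<open>Sharp constant and extremals for \<open>0 < \<theta> < 1\<close>\<close>

locale optimal_parameter =
  fixes \<theta> a :: real
  assumes \<theta>: "0 < \<theta>" "\<theta> < 1" and a_pos: "a > 0"
    and profile_less: "\<And>b. b > 0 \<Longrightarrow> b \<noteq> a \<Longrightarrow> profile \<theta> b < profile \<theta> a"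
begin

definition best :: real where
  "best = 1 / (\<theta> powr \<theta> * (1 - \<theta>) powr (1 - \<theta>)) * profile \<theta> a"

lemma best_interp_rhs:
  "best * interp_rhs \<theta> u = (l2_norm u)\<^sup>2 powr \<theta> * (grad_norm u)\<^sup>2 powr (1 - \<theta>)
    / (\<theta> powr \<theta> * (1 - \<theta>) powr (1 - \<theta>)) * profile \<theta> a"
  by (simp add: best_def interp_rhs_eq)

text \<open>The point evaluation bound at a parameter adapted to \<open>u\<close> gives the product
  times \<open>profile \<theta> b\<close>, which is at most \<open>profile \<theta> a\<close>.
  Equality forces \<open>b = a\<close> by strictness of the maximum, and then equality in the point
  evaluation bound.\<close>

lemma interp_bound:
  assumes u: "u \<in> l2" "u \<noteq> (\<lambda>x. 0)"
  shows "(u (0, 0))\<^sup>2 \<le> best * interp_rhs \<theta> u"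
    "(u (0, 0))\<^sup>2 = best * interp_rhs \<theta> u \<Longrightarrow> u = (\<lambda>x. u (0, 0) / green a (0, 0) * green a x)"
proof -
  define M where "M = (l2_norm u)\<^sup>2"
  define N where "N = (grad_norm u)\<^sup>2"
  have MN: "M > 0" "N > 0" using norms_sq_pos[OF u] by (simp_all add: M_def N_def)
  \<comment> \<open>The parameter giving equality in Young's inequality for this particular
    \<open>u\<close>.\<close>
  define b where "b = \<theta> * N / ((1 - \<theta>) * M)"
  have b: "b > 0" using MN \<theta> by (simp add: b_def)
  let ?A = "M powr \<theta> * N powr (1 - \<theta>) / (\<theta> powr \<theta> * (1 - \<theta>) powr (1 - \<theta>))"
  have A: "?A > 0" using MN \<theta> by simp
  have "energy b u = ?A * b powr \<theta>"
    using young_energy_eq[OF \<theta> MN] by (simp add: energy_def M_def N_def b_def)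
  then have eq: "energy b u * green b (0, 0) = ?A * profile \<theta> b"
    by (simp add: profile_def)
  have rhs: "best * interp_rhs \<theta> u = ?A * profile \<theta> a"
    by (simp add: best_interp_rhs M_def N_def)
  note bound = point_eval_bound[OF b is_green_green[OF b] u(1), unfolded eq]
  have "profile \<theta> b \<le> profile \<theta> a" using profile_less[OF b] by fastforce
  then have le: "?A * profile \<theta> b \<le> ?A * profile \<theta> a" using A by (intro mult_left_mono) auto
  with bound(2) show "(u (0, 0))\<^sup>2 \<le> best * interp_rhs \<theta> u" unfolding rhs by linarith
  assume "(u (0, 0))\<^sup>2 = best * interp_rhs \<theta> u"
  then have u0: "(u (0, 0))\<^sup>2 = ?A * profile \<theta> b" "?A * profile \<theta> b = ?A * profile \<theta> a"
    using le bound(2) unfolding rhs by linarith+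
  then have "b = a" using A profile_less[OF b] by force
  then show "u = (\<lambda>x. u (0, 0) / green a (0, 0) * green a x)"
    using bound(3)[OF u0(1)] by simp
qed

text \<open>A squeeze: for multiples of the Green's function the point evaluation bound is an
  equality, Young's inequality at \<open>a\<close> bounds the product from above, and
  \<open>interp_bound\<close> gives the reverse.\<close>

lemma green_attains:
  assumes "c \<noteq> 0"
  defines "u \<equiv> \<lambda>x. c * green a x"
  shows "u \<in> l2" "u \<noteq> (\<lambda>x. 0)" "(u (0, 0))\<^sup>2 = best * interp_rhs \<theta> u"
proof -
  have g: "is_green a (green a)" "green a \<in> l2" "green a (0, 0) > 0"
    using is_green_green[OF a_pos] green_origin_pos[OF a_pos] by (auto simp: is_green_def)
  show u: "u \<in> l2" unfolding u_def by (intro l2_scale g)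
  have "u (0, 0) \<noteq> 0" using assms g by simp
  then show u0: "u \<noteq> (\<lambda>x. 0)" by auto
  define M where "M = (l2_norm u)\<^sup>2"
  define N where "N = (grad_norm u)\<^sup>2"
  have MN: "M > 0" "N > 0" using norms_sq_pos[OF u u0] by (simp_all add: M_def N_def)
  \<comment> \<open>Writing \<open>c G\<close> as \<open>G - (1 - c) G\<close> brings it into the
    form of \<open>energy_diff_green\<close>.\<close>
  have "energy a u = c\<^sup>2 * green a (0, 0)"
    using energy_diff_green[OF g(1,2), of "1 - c"] energy_green[OF g(1)]
    by (simp add: u_def algebra_simps power2_eq_square)
  then have "(u (0, 0))\<^sup>2 = (N + a * M) * green a (0, 0)"
    by (simp add: energy_def M_def N_def u_def power2_eq_square)
  moreover have "best * interp_rhs \<theta> u \<le> (N + a * M) * green a (0, 0)"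
    using mult_right_mono[OF young_energy[OF \<theta> MN a_pos], of "green a (0, 0)"] g
    by (simp add: best_interp_rhs M_def N_def profile_def mult.assoc)
  ultimately show "(u (0, 0))\<^sup>2 = best * interp_rhs \<theta> u"
    using interp_bound(1)[OF u u0] by linarith
qed

lemma interp_ineq_best: "interp_ineq \<theta> best"
  unfolding interp_ineq_def
proof
  fix u assume "u \<in> l2"
  then show "(u (0, 0))\<^sup>2 \<le> best * interp_rhs \<theta> u"
    using interp_bound(1)[of u] by (cases "u = (\<lambda>x. 0)") (auto simp: interp_rhs_zero)
qed

lemma sharp_const_eq: "sharp_const \<theta> = best"
  using sharp_const_eqI(1)[OF interp_ineq_best green_attains[of 1]] by simp

lemma sharp_const_least: "interp_ineq \<theta> C \<Longrightarrow> sharp_const \<theta> \<le> C"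
  using sharp_const_eqI(2)[OF interp_ineq_best green_attains[of 1]] by (simp add: sharp_const_eq)

lemma extremal_iff: "extremal \<theta> u \<longleftrightarrow> (\<exists>c. c \<noteq> 0 \<and> u = (\<lambda>x. c * green a x))"
proof
  assume "extremal \<theta> u"
  then have u: "u \<in> l2" "u \<noteq> (\<lambda>x. 0)" "(u (0, 0))\<^sup>2 = best * interp_rhs \<theta> u"
    by (auto simp: extremal_def sharp_const_eq)
  have eq: "u = (\<lambda>x. u (0, 0) / green a (0, 0) * green a x)"
    by (rule interp_bound(2)[OF u])
  moreover have "u (0, 0) / green a (0, 0) \<noteq> 0"
  proof
    assume "u (0, 0) / green a (0, 0) = 0"
    then have "u x = 0" for x using fun_cong[OF eq, of x] by (simp only: mult_zero_left)
    then show False using u(2) by blast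
  qed
  ultimately show "\<exists>c. c \<noteq> 0 \<and> u = (\<lambda>x. c * green a x)" by blast
next
  assume "\<exists>c. c \<noteq> 0 \<and> u = (\<lambda>x. c * green a x)"
  then show "extremal \<theta> u"
    using green_attains by (auto simp: extremal_def sharp_const_eq)
qed

lemma arg_max_profile:
  "is_arg_max (\<lambda>a. a powr \<theta> * green a (0, 0)) (\<lambda>a. a > 0) b \<longleftrightarrow> b = a"
  unfolding profile_def[symmetric] is_arg_max_def
  using a_pos profile_less by (metis less_asym)

end

lemma optimal_parameter_ex:
  assumes "0 < \<theta>" "\<theta> < 1"
  obtains a where "optimal_parameter \<theta> a"
  using profile_unique_max[OF assms] assms by (metis optimal_parameter.intro)

section \<open>The endpoint \<open>\<theta> = 1\<close>\<close>

lemma interp_ineq_one: "interp_ineq 1 1"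
  unfolding interp_ineq_def
proof
  fix u assume u: "u \<in> l2"
  show "(u (0, 0))\<^sup>2 \<le> 1 * interp_rhs 1 u"
  proof (cases "u = (\<lambda>x. 0)")
    case False
    \<comment> \<open>Since \<open>0 powr 0 = 0\<close>, the gradient factor equals 1 only because
      the gradient norm is positive.\<close>
    have "(grad_norm u)\<^sup>2 powr 0 = 1" "(l2_norm u)\<^sup>2 powr 1 = (l2_norm u)\<^sup>2"
      using norms_sq_pos[OF u False] by (simp_all del: zero_less_power2)
    then show ?thesis using l2_inner_ge[OF u, of "(0, 0)"] by (simp add: interp_rhs_eq l2_norm_sq)
  qed (simp add: interp_rhs_zero)
qed

lemma delta_attains: "delta \<in> l2" "delta \<noteq> (\<lambda>x. 0)" "(delta (0, 0))\<^sup>2 = 1 * interp_rhs 1 delta"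
proof -
  have d0: "delta (0, 0) = 1" by (simp add: delta_def)
  show l: "delta \<in> l2" by (rule delta_l2)
  show nz: "delta \<noteq> (\<lambda>x. 0)" using d0 by (metis zero_neq_one)
  have "(grad_norm delta)\<^sup>2 powr 0 = 1" using norms_sq_pos[OF l nz] by (simp del: zero_less_power2)
  then show "(delta (0, 0))\<^sup>2 = 1 * interp_rhs 1 delta"
    by (simp add: interp_rhs_eq l2_norm_sq l2_inner_delta d0)
qed

section \<open>Asymptotics of the sharp constant as \<open>\<theta>\<close> tends to 0\<close>

text \<open>For \<open>a \<le> 1\<close> the quantity \<open>1 - k\<^sup>2\<close> lies between
  \<open>a / 5\<close> and \<open>a\<close>, so the logarithmic bounds for the series become bounds
  in \<open>ln a\<close>.\<close>

lemma green_origin_log_bounds: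
  assumes "0 < a" "a \<le> 1"
  shows "- ln a / (pi * (4 + a)) \<le> green a (0, 0)" "green a (0, 0) \<le> 1 - ln a / (4 * pi)"
proof -
  define k where "k = 4 / (4 + a)"
  have k: "0 < k" "k < 1" "1 - k = a / (4 + a)" using assms by (auto simp: k_def field_simps)
  have k2: "0 \<le> k\<^sup>2" "k\<^sup>2 < 1" using k by (auto simp: power_less_one_iff)
  have G: "green a (0, 0) = weight_series (k\<^sup>2) / (4 + a)"
    using assms by (simp add: green_origin_eq k_def)
  have f: "1 - k\<^sup>2 = (1 - k) * (1 + k)" by (simp add: power2_eq_square algebra_simps)
  have "(1 - k) * (1 + k) \<le> (1 - k) * 2" using k by (intro mult_left_mono) auto
  also have "\<dots> \<le> a" unfolding k(3) using assms by (simp add: field_simps)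
  finally have "ln (1 - k\<^sup>2) \<le> ln a" using k2 assms f by simp
  then have "- ln a / pi \<le> - ln (1 - k\<^sup>2) / pi" by (simp add: divide_right_mono)
  then have "- ln a / pi \<le> weight_series (k\<^sup>2)" using weight_series_bounds(1)[OF k2] by linarith
  then have "- ln a / pi / (4 + a) \<le> weight_series (k\<^sup>2) / (4 + a)"
    using assms by (intro divide_right_mono) auto
  then show "- ln a / (pi * (4 + a)) \<le> green a (0, 0)" unfolding G by simp
  have "a / 5 \<le> 1 - k" unfolding k(3) using assms by (intro divide_left_mono) auto
  also have "\<dots> * 1 \<le> (1 - k) * (1 + k)" using k by (intro mult_left_mono) auto
  finally have "ln (a / 5) \<le> ln (1 - k\<^sup>2)" using assms k2 f by simp
  moreover have "ln (a / 5) = ln a - ln 5" using assms by (simp add: ln_div)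
  \<comment> \<open>A crude estimate suffices: with \<open>4 / pi \<le> 3\<close> the constant term
    becomes 4, and division by 4 leaves 1.\<close>
  moreover have "ln (5::real) \<le> 4" using ln_le_minus_one[of "5::real"] by simp
  ultimately have "- ln (1 - k\<^sup>2) \<le> 4 - ln a" by linarith
  then have "- ln (1 - k\<^sup>2) / pi \<le> (4 - ln a) / pi" by (intro divide_right_mono) auto
  also have "\<dots> = 4 / pi - ln a / pi" by (simp add: diff_divide_distrib)
  also have "4 / pi \<le> 3" using pi_ge_two by (simp add: field_simps)
  finally have "weight_series (k\<^sup>2) \<le> 4 - ln a / pi"
    using weight_series_bounds(2)[OF k2] by linarith
  then have "weight_series (k\<^sup>2) / 4 \<le> (4 - ln a / pi) / 4" by (rule divide_right_mono) simp
  moreover have "weight_series (k\<^sup>2) / (4 + a) \<le> weight_series (k\<^sup>2) / 4"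
    using weight_series_ge_1[OF k2] assms by (intro divide_left_mono) auto
  ultimately have "weight_series (k\<^sup>2) / (4 + a) \<le> (4 - ln a / pi) / 4" by (rule order_trans[rotated])
  also have "\<dots> = 1 - ln a / (4 * pi)" by (simp add: diff_divide_distrib)
  finally show "green a (0, 0) \<le> 1 - ln a / (4 * pi)" unfolding G .
qed

text \<open>For \<open>a \<le> 1\<close> put \<open>y = - \<theta> * ln a\<close>: the leading part
  is \<open>y * exp (- y)\<close> over \<open>4 * pi * \<theta>\<close>, and
  \<open>y * exp (- y) \<le> exp (- 1)\<close>. For \<open>a > 1\<close> the bound
  \<open>G(0,0) \<le> 1/a\<close> gives at most 1.\<close>

lemma profile_upper_bound:
  assumes "0 < \<theta>" "\<theta> < 1" "a > 0"
  shows "profile \<theta> a \<le> 1 / (4 * pi * exp 1 * \<theta>) + 1"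
proof (cases "a \<le> 1")
  case True
  define y where "y = - \<theta> * ln a"
  have y: "y \<ge> 0" using True assms by (simp add: y_def mult_nonneg_nonpos)
  have p: "a powr \<theta> = exp (- y)" using assms by (simp add: powr_def y_def)
  have "profile \<theta> a \<le> exp (- y) * (1 + y / (4 * pi * \<theta>))"
    unfolding profile_def p using green_origin_log_bounds(2)[OF assms(3) True] assms
    by (intro mult_left_mono) (simp_all add: y_def)
  also have "\<dots> = exp (- y) + (y * exp (- y)) / (4 * pi * \<theta>)" by (simp add: algebra_simps)
  also have "\<dots> \<le> 1 + exp (- 1) / (4 * pi * \<theta>)"
  proof (intro add_mono divide_right_mono)
    have "y \<le> exp (y - 1)" using exp_ge_add_one_self[of "y - 1"] by simp
    then have "y * exp (- y) \<le> exp (y - 1) * exp (- y)" by (intro mult_right_mono) auto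
    then show "y * exp (- y) \<le> exp (- 1)" by (simp add: exp_add[symmetric])
  qed (use y assms in auto)
  also have "\<dots> = 1 / (4 * pi * exp 1 * \<theta>) + 1" by (simp add: exp_minus field_simps)
  finally show ?thesis .
next
  case False
  have "profile \<theta> a \<le> a powr \<theta> * (1 / a)"
    unfolding profile_def using green_origin_le[OF assms(3)] by (intro mult_left_mono) auto
  also have "\<dots> \<le> a powr 1 * (1 / a)"
    using False assms by (intro mult_right_mono powr_mono) auto
  also have "\<dots> = 1" using assms by simp
  also have "1 \<le> 1 / (4 * pi * exp 1 * \<theta>) + 1" using assms by simp
  finally show ?thesis .
qed

text \<open>The test parameter corresponds to \<open>y = 1\<close> in
  \<open>profile_upper_bound\<close>, where \<open>y * exp (- y)\<close> is largest.\<close>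

lemma profile_lower_bound:
  assumes "0 < \<theta>"
  shows "1 / (pi * (4 + exp (- 1 / \<theta>)) * exp 1 * \<theta>) \<le> profile \<theta> (exp (- 1 / \<theta>))"
proof -
  let ?a = "exp (- 1 / \<theta>)"
  have a: "0 < ?a" "?a \<le> 1" "?a powr \<theta> = exp (- 1)" using assms by (simp_all add: powr_def)
  have "exp (- 1) * (1 / \<theta> / (pi * (4 + ?a))) \<le> profile \<theta> ?a"
    unfolding profile_def a(3) using green_origin_log_bounds(1)[OF a(1,2)]
    by (intro mult_left_mono) simp_all
  then show ?thesis by (simp add: exp_minus field_simps)
qed

text \<open>After multiplication by \<open>\<theta>\<close> both bounds tend to
  \<open>1 / (4 * pi * exp 1)\<close>, since \<open>w\<close> tends to 1 and
  \<open>exp (- 1 / \<theta>)\<close> to 0.\<close>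

lemma sharp_const_bounds:
  assumes "0 < \<theta>" "\<theta> < 1"
  defines "w \<equiv> \<theta> powr \<theta> * (1 - \<theta>) powr (1 - \<theta>)"
  shows "1 / (pi * (4 + exp (- 1 / \<theta>)) * exp 1) / w \<le> \<theta> * sharp_const \<theta>"
    "\<theta> * sharp_const \<theta> \<le> (1 / (4 * pi * exp 1) + \<theta>) / w"
proof -
  obtain a where "optimal_parameter \<theta> a" using optimal_parameter_ex assms by blast
  then interpret optimal_parameter \<theta> a .
  have w: "w > 0" using assms by simp
  have eq: "\<theta> * sharp_const \<theta> = \<theta> * profile \<theta> a / w"
    by (simp add: sharp_const_eq best_def w_def)
  have "1 / (pi * (4 + exp (- 1 / \<theta>)) * exp 1 * \<theta>) \<le> profile \<theta> (exp (- 1 / \<theta>))"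
    by (rule profile_lower_bound[OF assms(1)])
  also have "\<dots> \<le> profile \<theta> a" using profile_less[of "exp (- 1 / \<theta>)"] by fastforce
  finally have "\<theta> * (1 / (pi * (4 + exp (- 1 / \<theta>)) * exp 1 * \<theta>)) \<le> \<theta> * profile \<theta> a"
    using assms by (intro mult_left_mono) auto
  then show "1 / (pi * (4 + exp (- 1 / \<theta>)) * exp 1) / w \<le> \<theta> * sharp_const \<theta>"
    unfolding eq using w assms(1) by (intro divide_right_mono) auto
  have "\<theta> * profile \<theta> a \<le> \<theta> * (1 / (4 * pi * exp 1 * \<theta>) + 1)"
    using assms a_pos by (intro mult_left_mono profile_upper_bound) auto
  also have "\<dots> = 1 / (4 * pi * exp 1) + \<theta>" using assms(1) by (simp add: distrib_left)
  finally show "\<theta> * sharp_const \<theta> \<le> (1 / (4 * pi * exp 1) + \<theta>) / w"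
    unfolding eq using w by (intro divide_right_mono) auto
qed

lemma sharp_const_asymptotics:
  "(\<lambda>\<theta>. sharp_const \<theta> - 1 / (4 * pi * exp 1 * \<theta>)) \<in> o[at_right 0](\<lambda>\<theta>. 1 / \<theta>)"
proof (rule smalloI_tendsto)
  have ev: "eventually (\<lambda>\<theta>::real. 0 < \<theta> \<and> \<theta> < 1) (at_right 0)"
    by (auto simp: eventually_at_right_field intro: exI[of _ 1])
  then show "eventually (\<lambda>\<theta>::real. 1 / \<theta> \<noteq> 0) (at_right 0)" by eventually_elim auto
  have "((\<lambda>\<theta>. \<theta> * sharp_const \<theta>) \<longlongrightarrow> 1 / (4 * pi * exp 1)) (at_right 0)"
  proof (rule tendsto_sandwich)
    have const: "inverse pi * inverse (exp 1) / 4 = 1 / (4 * pi * exp (1 :: real))"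
      by (simp add: field_simps)
    show "eventually (\<lambda>\<theta>. 1 / (pi * (4 + exp (- 1 / \<theta>)) * exp 1) / (\<theta> powr \<theta> * (1 - \<theta>) powr (1 - \<theta>))
        \<le> \<theta> * sharp_const \<theta>) (at_right 0)"
      using ev by eventually_elim (rule sharp_const_bounds; simp)
    show "eventually (\<lambda>\<theta>. \<theta> * sharp_const \<theta>
        \<le> (1 / (4 * pi * exp 1) + \<theta>) / (\<theta> powr \<theta> * (1 - \<theta>) powr (1 - \<theta>))) (at_right 0)"
      using ev by eventually_elim (rule sharp_const_bounds; simp)
    have "((\<lambda>\<theta>::real. 1 / (pi * (4 + exp (- 1 / \<theta>)) * exp 1) / (\<theta> powr \<theta> * (1 - \<theta>) powr (1 - \<theta>)))
        \<longlongrightarrow> inverse pi * inverse (exp 1) / 4) (at_right 0)" by real_asymp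
    then show "((\<lambda>\<theta>::real. 1 / (pi * (4 + exp (- 1 / \<theta>)) * exp 1) / (\<theta> powr \<theta> * (1 - \<theta>) powr (1 - \<theta>)))
        \<longlongrightarrow> 1 / (4 * pi * exp 1)) (at_right 0)"
      unfolding const .
    show "((\<lambda>\<theta>::real. (1 / (4 * pi * exp 1) + \<theta>) / (\<theta> powr \<theta> * (1 - \<theta>) powr (1 - \<theta>)))
        \<longlongrightarrow> 1 / (4 * pi * exp 1)) (at_right 0)" by real_asymp
  qed
  then have "((\<lambda>\<theta>. \<theta> * sharp_const \<theta> - 1 / (4 * pi * exp 1)) \<longlongrightarrow> 0) (at_right 0)"
    using LIM_zero by blast
  moreover have "eventually (\<lambda>\<theta>. \<theta> * sharp_const \<theta> - 1 / (4 * pi * exp 1)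
      = (sharp_const \<theta> - 1 / (4 * pi * exp 1 * \<theta>)) / (1 / \<theta>)) (at_right 0)"
    using ev by eventually_elim (simp add: field_simps)
  ultimately show "((\<lambda>\<theta>. (sharp_const \<theta> - 1 / (4 * pi * exp 1 * \<theta>)) / (1 / \<theta>)) \<longlongrightarrow> 0) (at_right 0)"
    by (rule Lim_transform_eventually)
qed

theorem theorem3p1:
  shows "(\<forall>\<theta>\<in>{0<..1}. interp_ineq \<theta> (sharp_const \<theta>) \<and>
            (\<forall>C. interp_ineq \<theta> C \<longrightarrow> sharp_const \<theta> \<le> C)) \<and>
         (\<forall>a>0. green a (0, 0) = 2 / pi * (elliptic_K (4 / (4 + a)) / (4 + a))) \<and>
         (\<forall>\<theta>\<in>{0<..<1}. \<exists>a\<^sub>0.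
            is_arg_max (\<lambda>a. a powr \<theta> * green a (0, 0)) (\<lambda>a. a > 0) a\<^sub>0 \<and>
            (\<forall>b. is_arg_max (\<lambda>a. a powr \<theta> * green a (0, 0)) (\<lambda>a. a > 0) b \<longrightarrow> b = a\<^sub>0) \<and>
            sharp_const \<theta> =
              1 / (\<theta> powr \<theta> * (1 - \<theta>) powr (1 - \<theta>)) * (a\<^sub>0 powr \<theta> * green a\<^sub>0 (0, 0)) \<and>
            (\<forall>u. extremal \<theta> u \<longleftrightarrow> (\<exists>c. c \<noteq> 0 \<and> u = (\<lambda>x. c * green a\<^sub>0 x)))) \<and>
         sharp_const 1 = 1 \<and> extremal 1 delta \<and>
         (\<lambda>\<theta>. sharp_const \<theta> - 1 / (4 * pi * exp 1 * \<theta>)) \<in> o[at_right 0](\<lambda>\<theta>. 1 / \<theta>)"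
proof (intro conjI ballI)
  note one = sharp_const_eqI[OF interp_ineq_one delta_attains]
  show "sharp_const 1 = 1" by (rule one)
  show "extremal 1 delta" using delta_attains by (simp add: extremal_def one(1))
  show "\<forall>a>0. green a (0, 0) = 2 / pi * (elliptic_K (4 / (4 + a)) / (4 + a))"
    using green_origin_elliptic by blast
  show "(\<lambda>\<theta>. sharp_const \<theta> - 1 / (4 * pi * exp 1 * \<theta>)) \<in> o[at_right 0](\<lambda>\<theta>. 1 / \<theta>)"
    by (rule sharp_const_asymptotics)
  fix \<theta> :: real
  {
    assume "\<theta> \<in> {0<..<1}"
    then obtain a where "optimal_parameter \<theta> a" using optimal_parameter_ex by auto
    then interpret optimal_parameter \<theta> a .
    show "\<exists>a\<^sub>0.
      is_arg_max (\<lambda>a. a powr \<theta> * green a (0, 0)) (\<lambda>a. a > 0) a\<^sub>0 \<and>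
      (\<forall>b. is_arg_max (\<lambda>a. a powr \<theta> * green a (0, 0)) (\<lambda>a. a > 0) b \<longrightarrow> b = a\<^sub>0) \<and>
      sharp_const \<theta> =
        1 / (\<theta> powr \<theta> * (1 - \<theta>) powr (1 - \<theta>)) * (a\<^sub>0 powr \<theta> * green a\<^sub>0 (0, 0)) \<and>
      (\<forall>u. extremal \<theta> u \<longleftrightarrow> (\<exists>c. c \<noteq> 0 \<and> u = (\<lambda>x. c * green a\<^sub>0 x)))"
      using arg_max_profile extremal_iff sharp_const_eq unfolding best_def profile_def by blast
  }
  assume \<theta>: "\<theta> \<in> {0<..1}"
  show "interp_ineq \<theta> (sharp_const \<theta>)" "\<forall>C. interp_ineq \<theta> C \<longrightarrow> sharp_const \<theta> \<le> C"
  proof -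
    have "interp_ineq \<theta> (sharp_const \<theta>) \<and> (\<forall>C. interp_ineq \<theta> C \<longrightarrow> sharp_const \<theta> \<le> C)"
    proof (cases "\<theta> = 1")
      case True
      then show ?thesis using one interp_ineq_one by simp
    next
      case False
      then obtain a where "optimal_parameter \<theta> a" using \<theta> optimal_parameter_ex[of \<theta>] by auto
      then interpret optimal_parameter \<theta> a .
      show ?thesis using interp_ineq_best sharp_const_least by (simp add: sharp_const_eq)
    qed
    then show "interp_ineq \<theta> (sharp_const \<theta>)" "\<forall>C. interp_ineq \<theta> C \<longrightarrow> sharp_const \<theta> \<le> C"
      by blast+
  qed
qed

end
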